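(* Let $n\ge 3$. Then $\dim ZL^2(R_4,R_4)=(n+1)^2-2$, $\dim HL^2(R_4,R_4)=1$, and the class $\overline{\rho}$ forms a basis of $HL^2(R_4,R_4)$, where $\rho:R_4\times R_4\to R_4$ is the bilinear map given on basis elements by $$\rho(e_1,x)=e_1,\qquad \rho(e_i,x)=(i-2)e_i\ (3\le i\le n),\qquad \rho(x,e_1)=-e_1,\qquad \rho(x,x)=-e_{n-1},$$ all other values on pairs of basis elements being zero.
   Context: A Leibniz algebra over $\mathbb{C}$ is a complex vector space $L$ with a bilinear bracket satisfying $[x,[y,z]]=[[x,y],z]-[[x,z],y]$. For a Leibniz algebra $L$, $ZL^2(L,L)$ is the space of bilinear maps $\varphi:L\times L\to L$ such that for all $x,y,z\in L$ $$[x,\varphi(y,z)]-[\varphi(x,y),z]+[\varphi(x,z),y]+\varphi(x,[y,z])-\varphi([x,y],z)+\varphi([x,z],y)=0;$$ $BL^2(L,L)$ is the space of maps of the form $f(x,y)=[d(x),y]+[x,d(y)]-d([x,y])$ for some linear map $d:L\to L$; and $HL^2(L,L)=ZL^2(L,L)/BL^2(L,L)$. The bar denotes the class in $HL^2$. $R_4$ has basis $\{e_1,\dots,e_n,x\}$ and products (omitted products are zero): $[e_i,e_1]=e_{i+1}$ for $2\le i\le n-1$; $[x,e_1]=-e_1$; $[e_1,x]=e_1+e_n$; $[e_i,x]=(i+1-n)e_i$ for $2\le i\le n$; $[x,x]=-e_{n-1}$.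
   Formalization: The claim that the class of ρ is a basis of HL² is stated only for n ≥ 4: for n = 3, ρ is the coboundary of d with d(x)=x, d(e_1)=0, d(e_2)=e_2, d(e_3)=e_3, so its class is zero; both dimension claims are kept for all n ≥ 3. *)

theory Defs
  imports "Jordan_Normal_Form.VS_Connect" "HOL-Algebra.QuotRing"
begin

(* As for the locale algebra of HOL-Algebra, the multiplication of the module record is the
   product of the algebra: x \<otimes> y is the bracket [x,y]. The field one plays no role. *)

abbreviation complex_field :: "complex ring" where
  "complex_field \<equiv> class_ring"

definition bilinear_map ::
    "(complex, 'a, 'm) module_scheme \<Rightarrow> ('a \<times> 'a \<Rightarrow> 'a) \<Rightarrow> bool" where
  "bilinear_map L \<phi> \<longleftrightarrow>
     (\<forall>x\<in>carrier L. (\<lambda>y. \<phi> (x, y)) \<in> LinearCombinations.module_hom complex_field L L) \<and>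
     (\<forall>y\<in>carrier L. (\<lambda>x. \<phi> (x, y)) \<in> LinearCombinations.module_hom complex_field L L)"

locale leibniz_algebra = vectorspace complex_field L
  for L :: "(complex, 'a, 'm) module_scheme" (structure) +
  assumes bracket_bilinear: "bilinear_map L (\<lambda>(x, y). x \<otimes> y)"
    and leibniz_identity:
      "\<lbrakk>x \<in> carrier L; y \<in> carrier L; z \<in> carrier L\<rbrakk> \<Longrightarrow>
       x \<otimes> (y \<otimes> z) = (x \<otimes> y) \<otimes> z \<ominus> (x \<otimes> z) \<otimes> y"

section \<open>Second cohomology with values in the algebra itself\<close>

(* The vector space of bilinear maps L \<times> L \<rightarrow> L. The maps are undefined outside
   carrier L \<times> carrier L, so that two of them are equal iff they agree there. *)
definition bilinear_maps ::
    "(complex, 'a, 'm) module_scheme \<Rightarrow> (complex, 'a \<times> 'a \<Rightarrow> 'a) module" where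
  "bilinear_maps L =
     \<lparr>carrier = {\<phi> \<in> extensional (carrier L \<times> carrier L). bilinear_map L \<phi>},
      mult = undefined,
      one = undefined,
      zero = (\<lambda>p\<in>carrier L \<times> carrier L. \<zero>\<^bsub>L\<^esub>),
      add = (\<lambda>\<phi> \<psi>. \<lambda>p\<in>carrier L \<times> carrier L. \<phi> p \<oplus>\<^bsub>L\<^esub> \<psi> p),
      smult = (\<lambda>c \<phi>. \<lambda>p\<in>carrier L \<times> carrier L. c \<odot>\<^bsub>L\<^esub> \<phi> p)\<rparr>"

definition ZL2 ::
    "(complex, 'a, 'm) module_scheme \<Rightarrow> (complex, 'a \<times> 'a \<Rightarrow> 'a) module" where
  "ZL2 L = (bilinear_maps L)\<lparr>carrier :=
     {\<phi> \<in> carrier (bilinear_maps L). \<forall>x\<in>carrier L. \<forall>y\<in>carrier L. \<forall>z\<in>carrier L.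
        x \<otimes>\<^bsub>L\<^esub> \<phi> (y, z) \<ominus>\<^bsub>L\<^esub> \<phi> (x, y) \<otimes>\<^bsub>L\<^esub> z \<oplus>\<^bsub>L\<^esub> \<phi> (x, z) \<otimes>\<^bsub>L\<^esub> y
          \<oplus>\<^bsub>L\<^esub> \<phi> (x, y \<otimes>\<^bsub>L\<^esub> z) \<ominus>\<^bsub>L\<^esub> \<phi> (x \<otimes>\<^bsub>L\<^esub> y, z) \<oplus>\<^bsub>L\<^esub> \<phi> (x \<otimes>\<^bsub>L\<^esub> z, y)
        = \<zero>\<^bsub>L\<^esub>}\<rparr>"

definition coboundary ::
    "(complex, 'a, 'm) module_scheme \<Rightarrow> ('a \<Rightarrow> 'a) \<Rightarrow> 'a \<times> 'a \<Rightarrow> 'a" where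
  "coboundary L d =
     (\<lambda>(x, y)\<in>carrier L \<times> carrier L.
        d x \<otimes>\<^bsub>L\<^esub> y \<oplus>\<^bsub>L\<^esub> x \<otimes>\<^bsub>L\<^esub> d y \<ominus>\<^bsub>L\<^esub> d (x \<otimes>\<^bsub>L\<^esub> y))"

definition BL2 ::
    "(complex, 'a, 'm) module_scheme \<Rightarrow> ('a \<times> 'a \<Rightarrow> 'a) set" where
  "BL2 L = coboundary L ` LinearCombinations.module_hom complex_field L L"

(* The quotient V/W, with the additive cosets of W as elements; compare FactRing. Scaling is
   followed by saturation with W because a scaled coset need not be a coset (scalar zero). *)
definition quotient_space ::
    "(complex, 'v, 'm) module_scheme \<Rightarrow> 'v set \<Rightarrow> (complex, 'v set) module" where
  "quotient_space V W =
     \<lparr>carrier = a_rcosets\<^bsub>V\<^esub> W,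
      mult = undefined,
      one = undefined,
      zero = W,
      add = set_add V,
      smult = (\<lambda>c A. \<Union>a\<in>A. W +>\<^bsub>V\<^esub> (c \<odot>\<^bsub>V\<^esub> a))\<rparr>"

definition HL2 ::
    "(complex, 'a, 'm) module_scheme \<Rightarrow> (complex, ('a \<times> 'a \<Rightarrow> 'a) set) module" where
  "HL2 L = quotient_space (ZL2 L) (BL2 L)"

definition HL2_class ::
    "(complex, 'a, 'm) module_scheme \<Rightarrow> ('a \<times> 'a \<Rightarrow> 'a) \<Rightarrow> ('a \<times> 'a \<Rightarrow> 'a) set" where
  "HL2_class L \<phi> = BL2 L +>\<^bsub>ZL2 L\<^esub> \<phi>"

section \<open>The algebra \<open>R\<^sub>4\<close>\<close>

(* The basis of the (n+1)-dimensional space is unit_vec (n+1) i for i = 0,...,n;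
   index i \<ge> 1 stands for e_i and index 0 for x. *)

definition bilinear_extension ::
    "nat \<Rightarrow> (nat \<Rightarrow> nat \<Rightarrow> complex vec) \<Rightarrow> complex vec \<Rightarrow> complex vec \<Rightarrow> complex vec" where
  "bilinear_extension m t v w =
     vec m (\<lambda>k. \<Sum>i<m. \<Sum>j<m. v $ i * w $ j * t i j $ k)"

definition R4_products :: "nat \<Rightarrow> nat \<Rightarrow> nat \<Rightarrow> complex vec" where
  "R4_products n i j =
     (let e = unit_vec (n + 1) in
      if 2 \<le> i \<and> i \<le> n - 1 \<and> j = 1 then e (i + 1)
      else if i = 0 \<and> j = 1 then - e 1
      else if i = 1 \<and> j = 0 then e 1 + e n
      else if 2 \<le> i \<and> i \<le> n \<and> j = 0 then (of_nat i + 1 - of_nat n) \<cdot>\<^sub>v e i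
      else if i = 0 \<and> j = 0 then - e (n - 1)
      else 0\<^sub>v (n + 1))"

definition R4 :: "nat \<Rightarrow> (complex, complex vec) module" where
  "R4 n = (module_vec TYPE(complex) (n + 1))
     \<lparr>mult := bilinear_extension (n + 1) (R4_products n)\<rparr>"

definition rho_values :: "nat \<Rightarrow> nat \<Rightarrow> nat \<Rightarrow> complex vec" where
  "rho_values n i j =
     (let e = unit_vec (n + 1) in
      if i = 1 \<and> j = 0 then e 1
      else if 3 \<le> i \<and> i \<le> n \<and> j = 0 then (of_nat i - 2) \<cdot>\<^sub>v e i
      else if i = 0 \<and> j = 1 then - e 1
      else if i = 0 \<and> j = 0 then - e (n - 1)
      else 0\<^sub>v (n + 1))"

definition rho :: "nat \<Rightarrow> complex vec \<times> complex vec \<Rightarrow> complex vec" where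
  "rho n = (\<lambda>(v, w)\<in>carrier (R4 n) \<times> carrier (R4 n).
     bilinear_extension (n + 1) (rho_values n) v w)"

section \<open>The spaces above are vector spaces, and \<open>R\<^sub>4\<close> is a Leibniz algebra\<close>

lemma bilinear_maps_simps:
  "\<phi> \<in> carrier (bilinear_maps L) \<longleftrightarrow>
     \<phi> \<in> extensional (carrier L \<times> carrier L) \<and> bilinear_map L \<phi>"
  "\<zero>\<^bsub>bilinear_maps L\<^esub> = (\<lambda>p\<in>carrier L \<times> carrier L. \<zero>\<^bsub>L\<^esub>)"
  "\<phi> \<oplus>\<^bsub>bilinear_maps L\<^esub> \<psi> = (\<lambda>p\<in>carrier L \<times> carrier L. \<phi> p \<oplus>\<^bsub>L\<^esub> \<psi> p)"
  "c \<odot>\<^bsub>bilinear_maps L\<^esub> \<phi> = (\<lambda>p\<in>carrier L \<times> carrier L. c \<odot>\<^bsub>L\<^esub> \<phi> p)"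
  by (auto simp: bilinear_maps_def)

lemma bilinear_map_iff:
  "bilinear_map L \<phi> \<longleftrightarrow>
    (\<forall>x\<in>carrier L. \<forall>y\<in>carrier L. \<phi> (x, y) \<in> carrier L) \<and>
    (\<forall>x\<in>carrier L. \<forall>y\<in>carrier L. \<forall>z\<in>carrier L.
      \<phi> (x, y \<oplus>\<^bsub>L\<^esub> z) = \<phi> (x, y) \<oplus>\<^bsub>L\<^esub> \<phi> (x, z) \<and>
      \<phi> (x \<oplus>\<^bsub>L\<^esub> y, z) = \<phi> (x, z) \<oplus>\<^bsub>L\<^esub> \<phi> (y, z)) \<and>
    (\<forall>c. \<forall>x\<in>carrier L. \<forall>y\<in>carrier L.
      \<phi> (x, c \<odot>\<^bsub>L\<^esub> y) = c \<odot>\<^bsub>L\<^esub> \<phi> (x, y) \<and>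
      \<phi> (c \<odot>\<^bsub>L\<^esub> x, y) = c \<odot>\<^bsub>L\<^esub> \<phi> (x, y))"
  unfolding bilinear_map_def LinearCombinations.module_hom_def by (simp add: Pi_iff) blast

lemma bilinear_maps_vectorspace:
  fixes L (structure)
  assumes "vectorspace complex_field L"
  shows "vectorspace complex_field (bilinear_maps L)"
proof -
  interpret vectorspace complex_field L by fact
  have sr: "\<And>a x y. x \<in> carrier L \<Longrightarrow> y \<in> carrier L \<Longrightarrow> a \<odot> (x \<oplus> y) = a \<odot> x \<oplus> a \<odot> y"
    and sl: "\<And>a b x. x \<in> carrier L \<Longrightarrow> (a + b) \<odot> x = a \<odot> x \<oplus> b \<odot> x"
    and sa: "\<And>a b x. x \<in> carrier L \<Longrightarrow> (a * b) \<odot> x = a \<odot> (b \<odot> x)"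
    and sc: "\<And>a x. x \<in> carrier L \<Longrightarrow> a \<odot> x \<in> carrier L"
    and s1: "\<And>x. x \<in> carrier L \<Longrightarrow> 1 \<odot> x = x"
    and s0: "\<And>a. a \<odot> \<zero> = \<zero>"
    using smult_r_distr smult_l_distr smult_assoc1 smult_closed smult_one smult_r_null by auto
  have comm: "a \<odot> (b \<odot> x) = b \<odot> (a \<odot> x)" if "x \<in> carrier L" for a b x
    by (metis sa[OF that] mult.commute)
  have neg: "(-1) \<odot> x \<oplus> x = \<zero>" if "x \<in> carrier L" for x
    using smult_l_distr[of "-1" 1 x] smult_l_null[of x] smult_one[of x] that by simp
  let ?B = "bilinear_maps L"
  have *: "\<phi> p \<in> carrier L" if "\<phi> \<in> carrier ?B" "p \<in> carrier L \<times> carrier L" for \<phi> p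
    using that by (cases p) (auto simp: bilinear_maps_simps bilinear_map_iff)
  have eqI: "\<phi> = \<psi>" if "\<phi> \<in> extensional (carrier L \<times> carrier L)"
    "\<psi> \<in> extensional (carrier L \<times> carrier L)"
    "\<And>p. p \<in> carrier L \<times> carrier L \<Longrightarrow> \<phi> p = \<psi> p" for \<phi> \<psi> :: "'a \<times> 'a \<Rightarrow> 'a"
    using that by (rule extensionalityI)
  have add: "\<phi> \<oplus>\<^bsub>?B\<^esub> \<psi> \<in> carrier ?B" if "\<phi> \<in> carrier ?B" "\<psi> \<in> carrier ?B" for \<phi> \<psi>
    using that by (auto simp: bilinear_maps_simps bilinear_map_iff sr M.add.m_ac)
  have smult: "c \<odot>\<^bsub>?B\<^esub> \<phi> \<in> carrier ?B" if "\<phi> \<in> carrier ?B" for \<phi> c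
    using that by (auto simp: bilinear_maps_simps bilinear_map_iff sr sc comm)
  have zero: "\<zero>\<^bsub>?B\<^esub> \<in> carrier ?B"
    by (auto simp: bilinear_maps_simps bilinear_map_iff sc s0)
  show ?thesis
  proof (intro vectorspace.intro moduleI abelian_groupI class_field class_cring.cring_axioms)
    fix \<phi> assume \<phi>: "\<phi> \<in> carrier ?B"
    have "(-1) \<odot>\<^bsub>?B\<^esub> \<phi> \<oplus>\<^bsub>?B\<^esub> \<phi> = \<zero>\<^bsub>?B\<^esub>"
      using *[OF \<phi>] by (intro eqI) (auto simp: bilinear_maps_simps neg)
    then show "\<exists>\<psi>\<in>carrier ?B. \<psi> \<oplus>\<^bsub>?B\<^esub> \<phi> = \<zero>\<^bsub>?B\<^esub>"
      using smult[OF \<phi>] by blast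
  next
    fix \<phi> assume \<phi>: "\<phi> \<in> carrier ?B"
    show "\<zero>\<^bsub>?B\<^esub> \<oplus>\<^bsub>?B\<^esub> \<phi> = \<phi>"
      using \<phi> *[OF \<phi>] by (intro eqI) (auto simp: bilinear_maps_simps)
    show "\<one>\<^bsub>complex_field\<^esub> \<odot>\<^bsub>?B\<^esub> \<phi> = \<phi>"
      using \<phi> *[OF \<phi>] by (intro eqI) (auto simp: bilinear_maps_simps s1)
  qed (auto simp: add smult zero, (intro eqI; auto simp: bilinear_maps_simps * sr sl sa M.add.m_ac)+)
qed

lemma ZL2_simps:
  "\<zero>\<^bsub>ZL2 L\<^esub> = \<zero>\<^bsub>bilinear_maps L\<^esub>"
  "add (ZL2 L) = add (bilinear_maps L)"
  "smult (ZL2 L) = smult (bilinear_maps L)"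
  by (simp_all add: ZL2_def)

context leibniz_algebra
begin

lemma bracket_closed [simp]: "x \<in> carrier L \<Longrightarrow> y \<in> carrier L \<Longrightarrow> x \<otimes> y \<in> carrier L"
  using bracket_bilinear by (auto simp: bilinear_map_iff)

lemma bracket_add:
  assumes "x \<in> carrier L" "y \<in> carrier L" "z \<in> carrier L"
  shows "x \<otimes> (y \<oplus> z) = x \<otimes> y \<oplus> x \<otimes> z" "(x \<oplus> y) \<otimes> z = x \<otimes> z \<oplus> y \<otimes> z"
  using bracket_bilinear assms by (auto simp: bilinear_map_iff)

lemma bracket_smult:
  assumes "x \<in> carrier L" "y \<in> carrier L"
  shows "x \<otimes> (c \<odot> y) = c \<odot> (x \<otimes> y)" "(c \<odot> x) \<otimes> y = c \<odot> (x \<otimes> y)"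
  using bracket_bilinear assms by (auto simp: bilinear_map_iff)

lemma smult_closed' [simp]: "x \<in> carrier L \<Longrightarrow> c \<odot> x \<in> carrier L"
  using smult_closed[of c x] by simp

lemma uminus_smult: "x \<in> carrier L \<Longrightarrow> \<ominus> x = (-1) \<odot> x"
  using smult_l_distr[of "-1" 1 x] smult_l_null[of x] smult_one[of x]
  by (intro minus_equality) simp_all

lemma smult_uminus: "x \<in> carrier L \<Longrightarrow> c \<odot> (\<ominus> x) = \<ominus> (c \<odot> x)"
  using smult_r_minus[of c x] by simp

lemma smult_add: "x \<in> carrier L \<Longrightarrow> y \<in> carrier L \<Longrightarrow> c \<odot> (x \<oplus> y) = c \<odot> x \<oplus> c \<odot> y"
  using smult_r_distr[of c x y] by simp

lemma smult_commute: "x \<in> carrier L \<Longrightarrow> a \<odot> (b \<odot> x) = b \<odot> (a \<odot> x)"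
  using smult_assoc1[of a b x] smult_assoc1[of b a x] by (simp add: mult.commute)

lemma bracket_zero [simp]:
  assumes "x \<in> carrier L" shows "x \<otimes> \<zero> = \<zero>" "\<zero> \<otimes> x = \<zero>"
  using bracket_smult[of x \<zero> 0] bracket_smult[of \<zero> x 0] smult_l_null[of "x \<otimes> \<zero>"]
    smult_l_null[of "\<zero> \<otimes> x"] smult_r_null[of 0] assms by simp_all

lemma uminus_zero [simp]: "\<ominus> \<zero> = \<zero>"
  by (rule minus_equality) simp_all

lemma bracket_uminus:
  assumes "x \<in> carrier L" "y \<in> carrier L"
  shows "x \<otimes> (\<ominus> y) = \<ominus> (x \<otimes> y)" "(\<ominus> x) \<otimes> y = \<ominus> (x \<otimes> y)"
  using assms by (simp_all add: uminus_smult bracket_smult)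

lemma ZL2_submodule: "submodule complex_field (carrier (ZL2 L)) (bilinear_maps L)"
proof (rule submodule.intro)
  interpret B: vectorspace complex_field "bilinear_maps L"
    using vectorspace_axioms by (rule bilinear_maps_vectorspace)
  show "module complex_field (bilinear_maps L)" ..
  show "carrier (ZL2 L) \<subseteq> carrier (bilinear_maps L)"
    by (auto simp: ZL2_def)
  have *: "\<phi> (x, y) \<in> carrier L"
    if "\<phi> \<in> carrier (bilinear_maps L)" "x \<in> carrier L" "y \<in> carrier L" for \<phi> x y
    using that by (auto simp: bilinear_maps_simps bilinear_map_iff)
  show "\<zero>\<^bsub>bilinear_maps L\<^esub> \<in> carrier (ZL2 L)"
    using B.zero_closed
    by (auto simp: ZL2_def) (simp add: bilinear_maps_simps a_minus_def)
  show "\<phi> \<oplus>\<^bsub>bilinear_maps L\<^esub> \<psi> \<in> carrier (ZL2 L)"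
    if "\<phi> \<in> carrier (ZL2 L)" "\<psi> \<in> carrier (ZL2 L)" for \<phi> \<psi>
  proof -
    let ?E = "\<lambda>\<phi> x y z. x \<otimes> \<phi> (y, z) \<ominus> \<phi> (x, y) \<otimes> z \<oplus> \<phi> (x, z) \<otimes> y
          \<oplus> \<phi> (x, y \<otimes> z) \<ominus> \<phi> (x \<otimes> y, z) \<oplus> \<phi> (x \<otimes> z, y)"
    have m: "\<phi> \<in> carrier (bilinear_maps L)" "\<psi> \<in> carrier (bilinear_maps L)"
      using that by (auto simp: ZL2_def)
    have "?E (\<phi> \<oplus>\<^bsub>bilinear_maps L\<^esub> \<psi>) x y z = ?E \<phi> x y z \<oplus> ?E \<psi> x y z"
      if "x \<in> carrier L" "y \<in> carrier L" "z \<in> carrier L" for x y z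
      using that *[OF m(1)] *[OF m(2)]
      by (simp add: bilinear_maps_simps bracket_add a_minus_def M.minus_add M.add.m_ac)
    then show ?thesis
      using that B.add.m_closed[OF m] by (auto simp: ZL2_def)
  qed
  show "c \<odot>\<^bsub>bilinear_maps L\<^esub> \<phi> \<in> carrier (ZL2 L)"
    if "\<phi> \<in> carrier (ZL2 L)" for c \<phi>
  proof -
    let ?E = "\<lambda>\<phi> x y z. x \<otimes> \<phi> (y, z) \<ominus> \<phi> (x, y) \<otimes> z \<oplus> \<phi> (x, z) \<otimes> y
          \<oplus> \<phi> (x, y \<otimes> z) \<ominus> \<phi> (x \<otimes> y, z) \<oplus> \<phi> (x \<otimes> z, y)"
    have m: "\<phi> \<in> carrier (bilinear_maps L)"
      using that by (auto simp: ZL2_def)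
    have "?E (c \<odot>\<^bsub>bilinear_maps L\<^esub> \<phi>) x y z = c \<odot> ?E \<phi> x y z"
      if "x \<in> carrier L" "y \<in> carrier L" "z \<in> carrier L" for x y z
      using that *[OF m]
      by (simp add: bilinear_maps_simps bracket_smult smult_add smult_uminus a_minus_def)
    then show ?thesis
      using that B.smult_closed[OF _ m, of c] by (auto simp: ZL2_def)
  qed
qed

theorem ZL2_vectorspace: "vectorspace complex_field (ZL2 L)"
proof -
  interpret B: vectorspace complex_field "bilinear_maps L"
    using vectorspace_axioms by (rule bilinear_maps_vectorspace)
  have "ZL2 L = (bilinear_maps L)\<lparr>carrier := carrier (ZL2 L)\<rparr>"
    by (simp add: ZL2_def)
  then show ?thesis
    using B.submodule_is_module[OF ZL2_submodule] class_field
    by (metis vectorspace.intro)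
qed

lemma hom_simps:
  assumes "d \<in> LinearCombinations.module_hom complex_field L L"
  shows "x \<in> carrier L \<Longrightarrow> d x \<in> carrier L"
    "x \<in> carrier L \<Longrightarrow> y \<in> carrier L \<Longrightarrow> d (x \<oplus> y) = d x \<oplus> d y"
    "x \<in> carrier L \<Longrightarrow> d (c \<odot> x) = c \<odot> d x"
    "x \<in> carrier L \<Longrightarrow> d (\<ominus> x) = \<ominus> d x"
  using assms by (auto simp: LinearCombinations.module_hom_def uminus_smult Pi_iff)

lemma coboundary_in_ZL2:
  assumes d: "d \<in> LinearCombinations.module_hom complex_field L L"
  shows "coboundary L d \<in> carrier (ZL2 L)"
proof -
  note d = hom_simps[OF d]
  have "coboundary L d \<in> carrier (bilinear_maps L)"
    by (auto simp: coboundary_def bilinear_maps_simps bilinear_map_iff d bracket_add bracket_smult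
        smult_add smult_uminus a_minus_def M.minus_add M.add.m_ac)
  moreover have
    "x \<otimes> f (y, z) \<ominus> f (x, y) \<otimes> z \<oplus> f (x, z) \<otimes> y
     \<oplus> f (x, y \<otimes> z) \<ominus> f (x \<otimes> y, z) \<oplus> f (x \<otimes> z, y) = \<zero>"
    if c: "x \<in> carrier L" "y \<in> carrier L" "z \<in> carrier L" and f: "f = coboundary L d" for x y z f
  proof -
    define P where "P =
      x \<otimes> (d y \<otimes> z) \<oplus> x \<otimes> (y \<otimes> d z) \<oplus> d (x \<otimes> y) \<otimes> z \<oplus> d x \<otimes> z \<otimes> y \<oplus> x \<otimes> d z \<otimes> y
      \<oplus> d x \<otimes> (y \<otimes> z) \<oplus> x \<otimes> d (y \<otimes> z) \<oplus> d (x \<otimes> y \<otimes> z) \<oplus> d (x \<otimes> z) \<otimes> y \<oplus> x \<otimes> z \<otimes> d y"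
    define N where "N =
      x \<otimes> d (y \<otimes> z) \<oplus> d x \<otimes> y \<otimes> z \<oplus> x \<otimes> d y \<otimes> z \<oplus> d (x \<otimes> z) \<otimes> y \<oplus> d (x \<otimes> (y \<otimes> z))
      \<oplus> d (x \<otimes> y) \<otimes> z \<oplus> x \<otimes> y \<otimes> d z \<oplus> d (x \<otimes> z \<otimes> y)"
    have leib: "u \<otimes> (v \<otimes> w) \<oplus> u \<otimes> w \<otimes> v = u \<otimes> v \<otimes> w"
      if "u \<in> carrier L" "v \<in> carrier L" "w \<in> carrier L" for u v w
      using that leibniz_identity[of u v w]
      by (simp add: a_minus_def M.add.m_assoc M.l_neg)
    have "P = (x \<otimes> (d y \<otimes> z) \<oplus> x \<otimes> z \<otimes> d y) \<oplus> (x \<otimes> (y \<otimes> d z) \<oplus> x \<otimes> d z \<otimes> y)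
      \<oplus> (d x \<otimes> (y \<otimes> z) \<oplus> d x \<otimes> z \<otimes> y) \<oplus> d (x \<otimes> y \<otimes> z) \<oplus> d (x \<otimes> y) \<otimes> z
      \<oplus> x \<otimes> d (y \<otimes> z) \<oplus> d (x \<otimes> z) \<otimes> y"
      unfolding P_def using c by (simp add: d M.add.m_ac)
    also have "\<dots> = x \<otimes> d y \<otimes> z \<oplus> x \<otimes> y \<otimes> d z \<oplus> d x \<otimes> y \<otimes> z
      \<oplus> (d (x \<otimes> (y \<otimes> z)) \<oplus> d (x \<otimes> z \<otimes> y)) \<oplus> d (x \<otimes> y) \<otimes> z
      \<oplus> x \<otimes> d (y \<otimes> z) \<oplus> d (x \<otimes> z) \<otimes> y"
      using c leib[of x "d y" z] leib[of x y "d z"] leib[of "d x" y z] leib[of x y z]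
        d(2)[of "x \<otimes> (y \<otimes> z)" "x \<otimes> z \<otimes> y"]
      by (simp only: d bracket_closed)
    finally have "P = N"
      unfolding N_def using c by (simp add: d M.add.m_ac)
    moreover have "P \<in> carrier L" "N \<in> carrier L"
      unfolding P_def N_def using c by (simp_all add: d)
    moreover have "x \<otimes> f (y, z) \<ominus> f (x, y) \<otimes> z \<oplus> f (x, z) \<otimes> y
     \<oplus> f (x, y \<otimes> z) \<ominus> f (x \<otimes> y, z) \<oplus> f (x \<otimes> z, y) = P \<ominus> N"
      unfolding P_def N_def f coboundary_def using c
      by (simp add: d bracket_add bracket_uminus a_minus_def M.minus_add M.add.m_ac)
    ultimately show ?thesis by simp
  qed
  ultimately show ?thesis by (simp add: ZL2_def)
qed

lemma BL2_submodule: "submodule complex_field (BL2 L) (ZL2 L)"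
proof (rule submodule.intro)
  interpret Z: vectorspace complex_field "ZL2 L" by (rule ZL2_vectorspace)
  let ?H = "LinearCombinations.module_hom complex_field L L"
  show "module complex_field (ZL2 L)" ..
  show "BL2 L \<subseteq> carrier (ZL2 L)"
    using coboundary_in_ZL2 by (auto simp: BL2_def)
  have "(\<lambda>_. \<zero>) \<in> ?H"
    using smult_r_null by (auto simp: LinearCombinations.module_hom_def)
  moreover have "\<zero>\<^bsub>ZL2 L\<^esub> = coboundary L (\<lambda>_. \<zero>)"
    by (auto simp: coboundary_def ZL2_simps bilinear_maps_simps a_minus_def intro!: restrict_ext)
  ultimately show "\<zero>\<^bsub>ZL2 L\<^esub> \<in> BL2 L" by (auto simp: BL2_def)
  show "\<phi> \<oplus>\<^bsub>ZL2 L\<^esub> \<psi> \<in> BL2 L" if "\<phi> \<in> BL2 L" "\<psi> \<in> BL2 L" for \<phi> \<psi>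
  proof -
    from that obtain d d' where d: "d \<in> ?H" "d' \<in> ?H"
      and \<phi>: "\<phi> = coboundary L d" "\<psi> = coboundary L d'"
      by (auto simp: BL2_def)
    note h = hom_simps[OF d(1)] hom_simps[OF d(2)]
    have "(\<lambda>x. d x \<oplus> d' x) \<in> ?H"
      by (auto simp: LinearCombinations.module_hom_def h smult_add M.add.m_ac)
    moreover have "\<phi> \<oplus>\<^bsub>ZL2 L\<^esub> \<psi> = coboundary L (\<lambda>x. d x \<oplus> d' x)"
      unfolding \<phi> by (auto simp: coboundary_def ZL2_simps bilinear_maps_simps h bracket_add a_minus_def
          M.minus_add M.add.m_ac intro!: restrict_ext)
    ultimately show ?thesis by (auto simp: BL2_def)
  qed
  show "c \<odot>\<^bsub>ZL2 L\<^esub> \<phi> \<in> BL2 L" if "\<phi> \<in> BL2 L" for c \<phi>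
  proof -
    from that obtain d where d: "d \<in> ?H" and \<phi>: "\<phi> = coboundary L d"
      by (auto simp: BL2_def)
    note h = hom_simps[OF d]
    have "(\<lambda>x. c \<odot> d x) \<in> ?H"
      by (auto simp: LinearCombinations.module_hom_def h smult_add smult_commute)
    moreover have "c \<odot>\<^bsub>ZL2 L\<^esub> \<phi> = coboundary L (\<lambda>x. c \<odot> d x)"
      unfolding \<phi> by (auto simp: coboundary_def ZL2_simps bilinear_maps_simps h bracket_smult smult_add
          smult_uminus a_minus_def intro!: restrict_ext)
    ultimately show ?thesis by (auto simp: BL2_def)
  qed
qed

end

lemma submodule_abelian_subgroup:
  assumes "submodule complex_field W V" shows "abelian_subgroup W V"
proof -
  interpret W: submodule complex_field W V by fact
  interpret Module.module complex_field V by (rule W.module)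
  show ?thesis
  proof (rule abelian_subgroupI3)
    show "additive_subgroup W V"
    proof (intro additive_subgroup.intro subgroup.intro)
      fix x assume x: "x \<in> W"
      have "\<ominus>\<^bsub>V\<^esub> x = (-1) \<odot>\<^bsub>V\<^esub> x"
        using smult_l_distr[of "-1" 1 x] smult_l_null[of x] smult_one[of x] x W.subset
          smult_closed[of "-1" x]
        by (intro minus_equality) auto
      then show "inv\<^bsub>add_monoid V\<^esub> x \<in> W"
        using W.smult_closed[of "-1" x] x by (simp add: a_inv_def)
    qed (use W.subset in auto)
  qed unfold_locales
qed

lemma quotient_vectorspace:
  assumes V: "vectorspace complex_field V" and W: "submodule complex_field W V"
  shows "vectorspace complex_field (quotient_space V W)"
proof -
  interpret vectorspace complex_field V by fact
  interpret W: submodule complex_field W V by fact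
  interpret W: abelian_subgroup W V
    using W submodule_abelian_subgroup by blast
  let ?Q = "quotient_space V W" let ?c = "\<lambda>v. W +>\<^bsub>V\<^esub> v"
  have carrierI: "?c v \<in> carrier ?Q" if "v \<in> carrier V" for v
    using that by (auto simp: quotient_space_def A_RCOSETS_def')
  have carrierE: thesis
    if "X \<in> carrier ?Q" "\<And>v. v \<in> carrier V \<Longrightarrow> X = ?c v \<Longrightarrow> thesis" for X thesis
    using that by (auto simp: quotient_space_def A_RCOSETS_def')
  have add: "?c v \<oplus>\<^bsub>?Q\<^esub> ?c w = ?c (v \<oplus>\<^bsub>V\<^esub> w)" if "v \<in> carrier V" "w \<in> carrier V" for v w
    using that by (simp add: quotient_space_def W.a_rcos_sum)
  have smult: "a \<odot>\<^bsub>?Q\<^esub> ?c v = ?c (a \<odot>\<^bsub>V\<^esub> v)" if v: "v \<in> carrier V" for a v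
  proof -
    have "?c (a \<odot>\<^bsub>V\<^esub> u) = ?c (a \<odot>\<^bsub>V\<^esub> v)" if "u \<in> ?c v" for u
    proof -
      from that obtain w where w: "w \<in> W" "u = w \<oplus>\<^bsub>V\<^esub> v"
        by (auto simp: a_r_coset_def')
      then have "a \<odot>\<^bsub>V\<^esub> u = a \<odot>\<^bsub>V\<^esub> w \<oplus>\<^bsub>V\<^esub> a \<odot>\<^bsub>V\<^esub> v"
        using v W.subset smult_r_distr[of a w v] by auto
      then have "a \<odot>\<^bsub>V\<^esub> u \<in> ?c (a \<odot>\<^bsub>V\<^esub> v)"
        using w W.smult_closed[of a w] by (auto simp: a_r_coset_def')
      then show ?thesis
        using W.a_repr_independence'[of "a \<odot>\<^bsub>V\<^esub> u" "a \<odot>\<^bsub>V\<^esub> v"] v smult_closed[of a v] by simp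
    qed
    moreover have "v \<in> ?c v"
      using v W.a_rcos_self by simp
    ultimately have "(\<Union>u\<in>?c v. ?c (a \<odot>\<^bsub>V\<^esub> u)) = ?c (a \<odot>\<^bsub>V\<^esub> v)"
      by blast
    then show ?thesis by (simp add: quotient_space_def)
  qed
  have zero: "\<zero>\<^bsub>?Q\<^esub> = ?c \<zero>\<^bsub>V\<^esub>"
    using W.a_rcos_const[OF W.zero_closed] by (simp add: quotient_space_def)
  have sc: "a \<odot>\<^bsub>V\<^esub> v \<in> carrier V" if "v \<in> carrier V" for a v
    using smult_closed[of a v] that by simp
  have sr: "\<And>a x y. x \<in> carrier V \<Longrightarrow> y \<in> carrier V \<Longrightarrow> a \<odot>\<^bsub>V\<^esub> (x \<oplus>\<^bsub>V\<^esub> y) = a \<odot>\<^bsub>V\<^esub> x \<oplus>\<^bsub>V\<^esub> a \<odot>\<^bsub>V\<^esub> y"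
    and sl: "\<And>a b x. x \<in> carrier V \<Longrightarrow> (a + b) \<odot>\<^bsub>V\<^esub> x = a \<odot>\<^bsub>V\<^esub> x \<oplus>\<^bsub>V\<^esub> b \<odot>\<^bsub>V\<^esub> x"
    and sa: "\<And>a b x. x \<in> carrier V \<Longrightarrow> (a * b) \<odot>\<^bsub>V\<^esub> x = a \<odot>\<^bsub>V\<^esub> (b \<odot>\<^bsub>V\<^esub> x)"
    and s1: "\<And>x. x \<in> carrier V \<Longrightarrow> 1 \<odot>\<^bsub>V\<^esub> x = x"
    using smult_r_distr smult_l_distr smult_assoc1 smult_one by auto
  show ?thesis
  proof (intro vectorspace.intro moduleI abelian_groupI class_field class_cring.cring_axioms)
    fix X assume "X \<in> carrier ?Q"
    then obtain v where "v \<in> carrier V" "X = ?c v" by (rule carrierE)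
    then show "\<exists>Y\<in>carrier ?Q. Y \<oplus>\<^bsub>?Q\<^esub> X = \<zero>\<^bsub>?Q\<^esub>"
      by (intro bexI[of _ "?c (\<ominus>\<^bsub>V\<^esub> v)"] carrierI) (simp_all add: add zero M.l_neg)
  next
    show "\<zero>\<^bsub>?Q\<^esub> \<in> carrier ?Q" by (simp add: carrierI zero)
    fix X assume "X \<in> carrier ?Q"
    then show "\<zero>\<^bsub>?Q\<^esub> \<oplus>\<^bsub>?Q\<^esub> X = X" by (elim carrierE) (simp add: zero add)
  qed (elim carrierE, simp add: carrierI add smult sc sr sl sa s1 M.add.m_ac)+
qed

theorem (in leibniz_algebra) HL2_vectorspace: "vectorspace complex_field (HL2 L)"
  unfolding HL2_def using ZL2_vectorspace BL2_submodule by (rule quotient_vectorspace)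


lemma R4_simps:
  "carrier (R4 n) = carrier_vec (n + 1)" "add (R4 n) = (+)" "zero (R4 n) = 0\<^sub>v (n + 1)"
  "smult (R4 n) = (\<cdot>\<^sub>v)" "mult (R4 n) = bilinear_extension (n + 1) (R4_products n)"
  by (simp_all add: R4_def module_vec_simps)

lemma R4_vectorspace: "vectorspace complex_field (R4 n)"
proof (intro vectorspace.intro moduleI abelian_groupI class_field class_cring.cring_axioms)
  fix x assume "x \<in> carrier (R4 n)"
  then show "\<exists>y\<in>carrier (R4 n). y \<oplus>\<^bsub>R4 n\<^esub> x = \<zero>\<^bsub>R4 n\<^esub>"
    by (intro bexI[of _ "- x"]) (auto simp: R4_simps)
qed (auto simp: R4_simps smult_add_distrib_vec add_smult_distrib_vec smult_smult_assoc
     intro: assoc_add_vec comm_add_vec)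

lemma R4_a_minus:
  assumes "v \<in> carrier_vec (n + 1)" "w \<in> carrier_vec (n + 1)"
  shows "v \<ominus>\<^bsub>R4 n\<^esub> w = v - w"
proof -
  interpret vectorspace complex_field "R4 n" by (rule R4_vectorspace)
  have "\<ominus>\<^bsub>R4 n\<^esub> w = - w"
    by (rule minus_equality) (use assms in \<open>auto simp: R4_simps\<close>)
  then show ?thesis
    using assms by (simp add: a_minus_def R4_simps minus_add_uminus_vec)
qed

lemma R4_bracket_nth:
  assumes "3 \<le> n" "k \<le> n"
  shows "bilinear_extension (n + 1) (R4_products n) v w $ k =
    (if k = 1 then v $ 1 * w $ 0 - v $ 0 * w $ 1 else 0) + (if k = n then v $ 1 * w $ 0 else 0) +
    (if k \<ge> 3 then v $ (k - 1) * w $ 1 else 0) +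
    (if k \<ge> 2 then (of_nat k + 1 - of_nat n) * v $ k * w $ 0 else 0) -
    (if k = n - 1 then v $ 0 * w $ 0 else 0)"
proof -
  have split: "{..<n+1} = insert 0 (insert 1 {2..<n+1})" using assms by auto
  have z: "R4_products n i j $ k = 0" if "j \<ge> 2" for i j
    using that assms by (auto simp: R4_products_def Let_def)
  have inner: "(\<Sum>j<n+1. v $ i * w $ j * R4_products n i j $ k) =
     v $ i * w $ 0 * R4_products n i 0 $ k + v $ i * w $ 1 * R4_products n i 1 $ k" for i
    unfolding split by (subst sum.insert, simp, simp, subst sum.insert, simp, simp)
      (simp add: sum.neutral z)
  have a: "(\<Sum>i=2..<n+1. v $ i * w $ 0 * R4_products n i 0 $ k) =
     (\<Sum>i=2..<n+1. if i = k then (of_nat k + 1 - of_nat n) * v $ k * w $ 0 else 0)"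
    by (rule sum.cong) (use assms in \<open>auto simp: R4_products_def Let_def\<close>)
  have b: "(\<Sum>i=2..<n+1. v $ i * w $ 1 * R4_products n i 1 $ k) =
     (\<Sum>i=2..<n+1. if i = k - 1 then (if k \<ge> 3 then v $ (k - 1) * w $ 1 else 0) else 0)"
    by (rule sum.cong) (use assms in \<open>auto simp: R4_products_def Let_def\<close>)
  show ?thesis
    using assms unfolding bilinear_extension_def
    apply (simp only: index_vec less_Suc_eq_le Suc_eq_plus1[symmetric] inner[unfolded Suc_eq_plus1[symmetric]])
    apply (subst split[unfolded Suc_eq_plus1[symmetric]])
    apply (subst sum.insert, simp, simp, subst sum.insert, simp, simp)
    apply (simp only: sum.distrib a[unfolded Suc_eq_plus1[symmetric]] b[unfolded Suc_eq_plus1[symmetric]])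
    apply (auto simp: R4_products_def Let_def algebra_simps)
    done
qed

lemma bilinear_extension_carrier [simp]: "bilinear_extension m t v w \<in> carrier_vec m"
  by (simp add: bilinear_extension_def)

lemma bilinear_extension_bilinear:
  "bilinear_map (R4 n) (\<lambda>(v, w). bilinear_extension (n + 1) t v w)"
  unfolding bilinear_map_def LinearCombinations.module_hom_def
  by (auto simp: R4_simps bilinear_extension_def algebra_simps sum.distrib sum_distrib_left
      intro!: eq_vecI)

theorem R4_leibniz:
  assumes "3 \<le> n" shows "leibniz_algebra (R4 n)"
proof -
  interpret vectorspace complex_field "R4 n" by (rule R4_vectorspace)
  show ?thesis
  proof
    show "bilinear_map (R4 n) (\<lambda>(x, y). x \<otimes>\<^bsub>R4 n\<^esub> y)"
      using bilinear_extension_bilinear by (simp add: R4_simps)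
  next
    fix x y z
    assume "x \<in> carrier (R4 n)" "y \<in> carrier (R4 n)" "z \<in> carrier (R4 n)"
    show "x \<otimes>\<^bsub>R4 n\<^esub> (y \<otimes>\<^bsub>R4 n\<^esub> z) =
          x \<otimes>\<^bsub>R4 n\<^esub> y \<otimes>\<^bsub>R4 n\<^esub> z \<ominus>\<^bsub>R4 n\<^esub> x \<otimes>\<^bsub>R4 n\<^esub> z \<otimes>\<^bsub>R4 n\<^esub> y"
    proof -
      define b where "b = bilinear_extension (n + 1) (R4_products n)"
      have d: "dim_vec (b v w) = Suc n" for v w
        by (simp add: b_def bilinear_extension_def)
      note b_nth = R4_bracket_nth[OF assms, folded b_def]
      have "b x (b y z) = b (b x y) z - b (b x z) y"
      proof (rule eq_vecI)
        fix k assume "k < dim_vec (b (b x y) z - b (b x z) y)"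
        then have k: "k \<le> n" by (simp add: d)
        have n: "n \<noteq> Suc 0" "n \<noteq> 0" "n - 1 \<noteq> 0" "n - 1 \<noteq> 1" using assms by auto
        consider "k \<le> 2" | "k \<ge> 3" by linarith
        then show "b x (b y z) $ k = (b (b x y) z - b (b x z) y) $ k"
        proof cases
          case 1
          then have "k = 0 \<or> k = 1 \<or> k = 2" by auto
          then show ?thesis
            using assms k n by (elim disjE) (auto simp: d b_nth algebra_simps)
        next
          case 2
          then have k': "k - 1 \<le> n" "k - 1 \<noteq> n" "k - 1 \<noteq> 1" "k \<noteq> 1" "k - 1 \<ge> 2"
            "of_nat (k - 1) = (of_nat k - 1 :: complex)" using k by auto
          consider "k = n" | "k = n - 1" "k \<noteq> n" | "k \<noteq> n" "k \<noteq> n - 1" by blast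
          then show ?thesis
            using 2 k k' assms n by cases (auto simp: d b_nth algebra_simps)
        qed
      qed (simp add: d)
      then show ?thesis
        by (simp only: R4_simps R4_a_minus bilinear_extension_carrier b_def)
    qed
  qed
qed

section \<open>The case \<open>n = 3\<close>\<close>

(* For n = 3 the cocycle rho is the coboundary of the linear map with x \<mapsto> x, e_1 \<mapsto> 0,
   e_2 \<mapsto> e_2, e_3 \<mapsto> e_3, so its class vanishes; for this n it cannot be a basis of HL2. *)

theorem rho_in_BL2_R4_3: "rho 3 \<in> BL2 (R4 3)"
proof -
  define d :: "complex vec \<Rightarrow> complex vec" where "d v = vec 4 (\<lambda>k. if k = 1 then 0 else v $ k)" for v
  have "d \<in> LinearCombinations.module_hom complex_field (R4 3) (R4 3)"
    by (auto simp: LinearCombinations.module_hom_def R4_simps d_def intro!: eq_vecI)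
  moreover have "rho 3 = coboundary (R4 3) d"
    unfolding rho_def coboundary_def
  proof (rule restrict_ext, clarify)
    fix v w assume vw: "v \<in> carrier (R4 3)" "w \<in> carrier (R4 3)"
    define b where "b = bilinear_extension (3 + 1) (R4_products 3)"
    have d: "dim_vec (b v w) = 4" "dim_vec (d v) = 4" for v w
      by (simp_all add: b_def d_def bilinear_extension_def)
    note b_nth = R4_bracket_nth[of 3, folded b_def, simplified]
    have "bilinear_extension (3 + 1) (rho_values 3) v w = b (d v) w + b v (d w) - d (b v w)"
    proof (rule eq_vecI)
      fix k assume "k < dim_vec (b (d v) w + b v (d w) - d (b v w))"
      then have "k = 0 \<or> k = 1 \<or> k = 2 \<or> k = 3" by (auto simp: d)
      moreover have "{..<4::nat} = {0, 1, 2, 3}" by auto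
      ultimately show "bilinear_extension (3 + 1) (rho_values 3) v w $ k =
          (b (d v) w + b v (d w) - d (b v w)) $ k"
        by (elim disjE) (simp_all add: bilinear_extension_def rho_values_def Let_def d b_nth
            algebra_simps, simp_all add: d_def b_nth algebra_simps)
    qed (simp add: d bilinear_extension_def)
    moreover have "b v w \<in> carrier_vec (3 + 1)" "d v \<in> carrier_vec (3 + 1)" for v w
      by (simp_all add: b_def d_def bilinear_extension_def)
    ultimately show "bilinear_extension (3 + 1) (rho_values 3) v w =
        d v \<otimes>\<^bsub>R4 3\<^esub> w \<oplus>\<^bsub>R4 3\<^esub> v \<otimes>\<^bsub>R4 3\<^esub> d w \<ominus>\<^bsub>R4 3\<^esub> d (v \<otimes>\<^bsub>R4 3\<^esub> w)"
      by (simp only: R4_simps b_def[symmetric] R4_a_minus add_carrier_vec)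
  qed
  ultimately show ?thesis by (auto simp: BL2_def)
qed

theorem class_rho_R4_3:
  "HL2_class (R4 3) (rho 3) = \<zero>\<^bsub>HL2 (R4 3)\<^esub>"
  "\<not> vectorspace.basis complex_field (HL2 (R4 3)) {HL2_class (R4 3) (rho 3)}"
proof -
  interpret L: leibniz_algebra "R4 3" by (rule R4_leibniz) simp
  interpret B: abelian_subgroup "BL2 (R4 3)" "ZL2 (R4 3)"
    using L.BL2_submodule by (rule submodule_abelian_subgroup)
  interpret H: vectorspace complex_field "HL2 (R4 3)" by (rule L.HL2_vectorspace)
  show *: "HL2_class (R4 3) (rho 3) = \<zero>\<^bsub>HL2 (R4 3)\<^esub>"
    using B.a_rcos_const[OF rho_in_BL2_R4_3]
    by (simp add: HL2_class_def HL2_def quotient_space_def)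
  show "\<not> H.basis {HL2_class (R4 3) (rho 3)}"
    using H.vs_zero_lin_dep[of "{\<zero>\<^bsub>HL2 (R4 3)\<^esub>}"] unfolding * H.basis_def by auto
qed

end

theory Submission
  imports Defs
begin

text \<open>
  Since \<open>[y,z] + [z,y]\<close> runs through multiples of all \<open>e\<^sub>j\<close> with \<open>j \<ge> 2\<close>, the symmetrized cocycle identity
  forces \<open>\<phi>(a, e\<^sub>j) = [a, u\<^sub>j]\<close>, so \<open>\<phi>\<close> is governed by \<open>\<phi>(\<cdot>, x)\<close> and \<open>\<phi>(\<cdot>, e\<^sub>1)\<close>. These are linked only by
  the identity for \<open>(a, e\<^sub>1, x)\<close>, in which the right multiplication by \<open>x\<close> acts on \<open>e\<^sub>2, \<dots>, e\<^sub>n\<close> with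
  distinct eigenvalues; reading it off entry by entry shows which entries of \<open>\<phi>\<close> are free.
  Let \<open>\<sigma>\<close> be the cocycle with \<open>\<sigma>(e\<^sub>i, x) = e\<^sub>i\<close> for \<open>i \<ge> 2\<close> and zero otherwise. Choosing the matrix of \<open>d\<close> and
  the scalar \<open>c\<close> to match the free entries, every cocycle is uniquely of the form \<open>\<delta>d + c\<sigma>\<close>, where \<open>d\<close> has
  zero coefficients of \<open>e\<^sub>1\<close> in \<open>d x\<close> and of \<open>e\<^sub>1\<close> and \<open>e\<^sub>n\<close> in \<open>d e\<^sub>1\<close> (this removes the three-dimensional
  space of derivations). The functional \<open>\<delta>d + c\<sigma> \<mapsto> c\<close> has kernel \<open>BL\<^sup>2\<close> and takes the value \<open>n - 3\<close> at \<open>\<rho>\<close>.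
\<close>

section \<open>Dimensions and one-dimensional quotients\<close>

text \<open>Functions supported on \<open>S\<close> serve as coordinates. Enumerating
  \<open>S\<close> turns \<open>T\<close> into a linear bijection from the vectors of length
  \<open>card S\<close>, whose dimension is known. Linearity is stated for all functions,
  bijectivity only for supported ones, so the function space itself never has to become a vector
  space.\<close>

lemma dim_eq_card:
  fixes V (structure) and T :: "('i \<Rightarrow> complex) \<Rightarrow> 'v"
  assumes V: "vectorspace complex_field V" and S: "finite S"
    and closed: "\<And>f. T f \<in> carrier V"
    and add: "\<And>f g. T (\<lambda>i. f i + g i) = T f \<oplus> T g"
    and smult: "\<And>c f. T (\<lambda>i. c * f i) = c \<odot> T f"
    and inj: "\<And>f. \<lbrakk>\<And>i. i \<notin> S \<Longrightarrow> f i = 0; T f = \<zero>\<rbrakk> \<Longrightarrow> f = (\<lambda>_. 0)"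
    and surj: "\<And>v. v \<in> carrier V \<Longrightarrow> \<exists>f. (\<forall>i. i \<notin> S \<longrightarrow> f i = 0) \<and> v = T f"
  shows "vectorspace.fin_dim complex_field V \<and> vectorspace.dim complex_field V = card S"
proof -
  define m where "m = card S"
  obtain h where h: "bij_betw h S {0..<m}"
    using ex_bij_betw_finite_nat[OF S] m_def by blast
  have hS: "h i < m" if "i \<in> S" for i
    using h that by (auto dest: bij_betwE)
  define F where "F x = (\<lambda>i. if i \<in> S then (x :: complex vec) $ h i else 0)" for x
  interpret U: vec_space "TYPE(complex)" m .
  interpret V: vectorspace complex_field V by fact
  interpret W: linear_map complex_field U.V V "T \<circ> F"
  proof
    have "F (x + y) = (\<lambda>i. F x i + F y i)" "F (c \<cdot>\<^sub>v x) = (\<lambda>i. c * F x i)"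
      if "x \<in> carrier_vec m" "y \<in> carrier_vec m" for c x y
      using that hS by (auto simp: F_def)
    then show "T \<circ> F \<in> LinearCombinations.module_hom complex_field U.V V"
      by (auto simp: LinearCombinations.module_hom_def closed add smult)
  qed
  have carrier: "(T \<circ> F) ` carrier_vec m = carrier V"
  proof (intro subset_antisym subsetI)
    fix v assume "v \<in> carrier V"
    then obtain f where f: "\<And>i. i \<notin> S \<Longrightarrow> f i = 0" "v = T f" using surj by blast
    have "f = F (vec m (\<lambda>j. f (inv_into S h j)))"
      using f(1) hS bij_betw_inv_into_left[OF h] by (auto simp: F_def)
    then show "v \<in> (T \<circ> F) ` carrier_vec m"
      unfolding f(2) by (auto intro!: image_eqI[of _ _ "vec m (\<lambda>j. f (inv_into S h j))"])
  qed (auto simp: closed)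
  have "x = 0\<^sub>v m" if x: "x \<in> carrier_vec m" "T (F x) = \<zero>" for x
  proof (rule eq_vecI)
    fix j assume "j < dim_vec (0\<^sub>v m :: complex vec)"
    then obtain i where i: "i \<in> S" "j = h i" "j < m"
      using h by (auto simp: bij_betw_def) (metis atLeastLessThan_iff imageE le0)
    have "F x = (\<lambda>_. 0)" using inj[OF _ x(2)] by (simp add: F_def)
    then have "F x i = 0" by metis
    then show "x $ j = 0\<^sub>v m $ j" using i by (simp add: F_def)
  qed (use x in auto)
  moreover have "T (F (0\<^sub>v m)) = \<zero>"
    using W.T0_is_0 by simp
  ultimately have "inj_on (T \<circ> F) (carrier U.V)"
    by (intro W.Ke0_imp_inj) (auto simp: W.ker_def)
  then show ?thesis
    using W.dim_eq W.surj_fin_dim carrier U.fin_dim U.dim_is_n by (simp add: module_vec_simps m_def)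
qed

lemma basis_singleton:
  fixes V (structure)
  assumes V: "vectorspace complex_field V" and v: "v \<in> carrier V" "v \<noteq> \<zero>"
    and gen: "\<And>x. x \<in> carrier V \<Longrightarrow> \<exists>c. x = c \<odot> v"
  shows "vectorspace.fin_dim complex_field V" "vectorspace.dim complex_field V = 1"
    "vectorspace.basis complex_field V {v}"
proof -
  interpret vectorspace complex_field V by fact
  have sub: "submodule complex_field (span {v}) V"
    using v by (intro span_is_submodule) simp
  have "x \<in> span {v}" if "x \<in> carrier V" for x
    using gen[OF that] submodule.smult_closed[OF sub] span_self[OF v(1)] by auto
  moreover have "span {v} \<subseteq> carrier V"
    using v by (intro span_is_subset2) simp
  ultimately have span: "span {v} = carrier V" by blast
  show "fin_dim" unfolding fin_dim_def using span v(1) by blast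
  show dim: "dim = 1" using dim1I[OF span v(2,1)] .
  show "basis {v}" by (rule dim_gen_is_basis) (use span v dim in auto)
qed

text \<open>All representatives of a coset yield the same scaled coset, so the union that defines
  scaling collapses to one coset, also for the scalar zero.\<close>

lemma quotient_space_smult:
  assumes V: "vectorspace complex_field V" and W: "submodule complex_field W V"
    and v: "v \<in> carrier V"
  shows "a \<odot>\<^bsub>quotient_space V W\<^esub> (W +>\<^bsub>V\<^esub> v) = W +>\<^bsub>V\<^esub> (a \<odot>\<^bsub>V\<^esub> v)"
proof -
  interpret vectorspace complex_field V by fact
  interpret W: submodule complex_field W V by fact
  interpret W: abelian_subgroup W V
    using W submodule_abelian_subgroup by blast
  have "W +>\<^bsub>V\<^esub> (a \<odot>\<^bsub>V\<^esub> u) = W +>\<^bsub>V\<^esub> (a \<odot>\<^bsub>V\<^esub> v)" if "u \<in> W +>\<^bsub>V\<^esub> v" for u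
  proof -
    from that obtain w where w: "w \<in> W" "u = w \<oplus>\<^bsub>V\<^esub> v"
      by (auto simp: a_r_coset_def')
    then have "a \<odot>\<^bsub>V\<^esub> u = a \<odot>\<^bsub>V\<^esub> w \<oplus>\<^bsub>V\<^esub> a \<odot>\<^bsub>V\<^esub> v"
      using v W.subset smult_r_distr[of a w v] by auto
    then have "a \<odot>\<^bsub>V\<^esub> u \<in> W +>\<^bsub>V\<^esub> (a \<odot>\<^bsub>V\<^esub> v)"
      using w W.smult_closed[of a w] by (auto simp: a_r_coset_def')
    then show ?thesis
      using W.a_repr_independence'[of "a \<odot>\<^bsub>V\<^esub> u" "a \<odot>\<^bsub>V\<^esub> v"] v smult_closed[of a v] by simp
  qed
  moreover have "v \<in> W +>\<^bsub>V\<^esub> v"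
    using v W.a_rcos_self by simp
  ultimately have "(\<Union>u\<in>W +>\<^bsub>V\<^esub> v. W +>\<^bsub>V\<^esub> (a \<odot>\<^bsub>V\<^esub> u)) = W +>\<^bsub>V\<^esub> (a \<odot>\<^bsub>V\<^esub> v)"
    by blast
  then show ?thesis by (simp add: quotient_space_def)
qed

lemma quotient_space_coset_eq_zero_iff:
  assumes V: "vectorspace complex_field V" and W: "submodule complex_field W V"
    and v: "v \<in> carrier V"
  shows "W +>\<^bsub>V\<^esub> v = \<zero>\<^bsub>quotient_space V W\<^esub> \<longleftrightarrow> v \<in> W"
proof -
  interpret vectorspace complex_field V by fact
  interpret W: submodule complex_field W V by fact
  interpret W: abelian_subgroup W V
    using W submodule_abelian_subgroup by blast
  show ?thesis
    using W.a_rcos_const W.a_rcos_self[OF v] by (auto simp: quotient_space_def)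
qed

text \<open>\<open>\<kappa>\<close> induces an injective functional on the quotient, which therefore
  has dimension at most one; a vector with \<open>\<kappa> v \<noteq> 0\<close> has a nonzero class
  and hence spans.\<close>

lemma quotient_space_basis_singleton:
  fixes V (structure) and \<kappa> :: "'v \<Rightarrow> complex"
  assumes V: "vectorspace complex_field V" and W: "submodule complex_field W V"
    and ker: "\<And>u. u \<in> carrier V \<Longrightarrow> u \<in> W \<longleftrightarrow> \<kappa> u = 0"
    and add: "\<And>u v. \<lbrakk>u \<in> carrier V; v \<in> carrier V\<rbrakk> \<Longrightarrow> \<kappa> (u \<oplus> v) = \<kappa> u + \<kappa> v"
    and smult: "\<And>c u. u \<in> carrier V \<Longrightarrow> \<kappa> (c \<odot> u) = c * \<kappa> u"
    and v: "v \<in> carrier V" "\<kappa> v \<noteq> 0"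
  shows "vectorspace.fin_dim complex_field (quotient_space V W)"
    "vectorspace.dim complex_field (quotient_space V W) = 1"
    "vectorspace.basis complex_field (quotient_space V W) {W +> v}"
proof -
  interpret vectorspace complex_field V by fact
  interpret W: submodule complex_field W V by fact
  interpret W: abelian_subgroup W V
    using W submodule_abelian_subgroup by blast
  let ?Q = "quotient_space V W"
  have Q: "vectorspace complex_field ?Q"
    using V W by (rule quotient_vectorspace)
  have 1: "W +> v \<in> carrier ?Q"
    using v by (auto simp: quotient_space_def A_RCOSETS_def')
  have 2: "W +> v \<noteq> \<zero>\<^bsub>?Q\<^esub>"
    using v ker[OF v(1)] by (simp add: quotient_space_coset_eq_zero_iff[OF V W])
  have sc: "c \<odot> u \<in> carrier V" if "u \<in> carrier V" for c u
    using that smult_closed[of c u] by simp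
  have 3: "\<exists>c. X = c \<odot>\<^bsub>?Q\<^esub> (W +> v)" if X: "X \<in> carrier ?Q" for X
  proof -
    obtain u where u: "u \<in> carrier V" "X = W +> u"
      using X by (auto simp: quotient_space_def A_RCOSETS_def')
    \<comment> \<open>This scalar puts \<open>u\<close> minus \<open>c\<close> times
      \<open>v\<close> into the kernel of \<open>\<kappa>\<close>, that is, into
      \<open>W\<close>.\<close>
    define c where "c = \<kappa> u / \<kappa> v"
    have "u \<oplus> (- c) \<odot> v \<in> W"
      using u v sc by (subst ker) (auto simp: add smult c_def)
    moreover have "u = (u \<oplus> (- c) \<odot> v) \<oplus> c \<odot> v"
      using u v sc smult_l_distr[of "- c" c v] smult_l_null[of v] by (simp add: M.add.m_assoc)
    ultimately have "u \<in> W +> (c \<odot> v)"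
      by (auto simp: a_r_coset_def')
    then have "X = W +> (c \<odot> v)"
      using W.a_repr_independence'[of u "c \<odot> v"] v sc u by simp
    then show ?thesis
      using quotient_space_smult[OF V W v(1)] by auto
  qed
  show "vectorspace.fin_dim complex_field ?Q" "vectorspace.dim complex_field ?Q = 1"
    "vectorspace.basis complex_field ?Q {W +> v}"
    using basis_singleton[OF Q 1 2 3] by auto
qed

section \<open>Linear and bilinear maps on \<open>R\<^sub>4\<close>\<close>

definition bracket :: "nat \<Rightarrow> complex vec \<Rightarrow> complex vec \<Rightarrow> complex vec" where
  "bracket n = bilinear_extension (n + 1) (R4_products n)"

text \<open>For k from 2 to n this is the eigenvalue of right multiplication by \<open>e 0\<close>
  (the element x of the algebra) at the k-th basis vector.\<close>

definition weight :: "nat \<Rightarrow> nat \<Rightarrow> complex" where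
  "weight n k = of_nat k + 1 - of_nat n"

text \<open>The cocycle \<open>\<sigma>\<close> of the overview: project the first argument onto the
  ideal spanned by the basis vectors with index at least 2, then multiply by the x-coordinate of the
  second.\<close>

definition ideal_cocycle :: "nat \<Rightarrow> complex vec \<times> complex vec \<Rightarrow> complex vec" where
  "ideal_cocycle n = (\<lambda>(v, w)\<in>carrier (R4 n) \<times> carrier (R4 n).
     vec (Suc n) (\<lambda>k. if 2 \<le> k then v $ k * w $ 0 else 0))"

text \<open>The pair \<open>(k, i)\<close> is row and column. Values of \<open>f\<close> outside the
  matrix have no effect on the map, which leaves room for one further parameter.\<close>

definition matrix_hom :: "nat \<Rightarrow> (nat \<times> nat \<Rightarrow> complex) \<Rightarrow> complex vec \<Rightarrow> complex vec" where
  "matrix_hom n f v = vec (Suc n) (\<lambda>k. \<Sum>i\<le>n. f (k, i) * v $ i)"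

lemma R4_carrier: "carrier (R4 n) = carrier_vec (Suc n)"
  by (simp add: R4_simps)

text \<open>Induction over truncations of \<open>v\<close>: each step adds one multiple of a basis
  vector.\<close>

lemma linear_eqI:
  fixes f g :: "complex vec \<Rightarrow> complex vec"
  assumes f: "f \<in> LinearCombinations.module_hom complex_field (R4 n) (R4 n)"
    and g: "g \<in> LinearCombinations.module_hom complex_field (R4 n) (R4 n)"
    and eq: "\<And>i. i \<le> n \<Longrightarrow> f (unit_vec (Suc n) i) = g (unit_vec (Suc n) i)"
    and v: "v \<in> carrier_vec (Suc n)"
  shows "f v = g v"
proof -
  define cut where "cut j = vec (Suc n) (\<lambda>i. if i < j then v $ i else 0)" for j
  have car: "cut j \<in> carrier_vec (Suc n)" for j by (simp add: cut_def)
  have hom: "h (r \<cdot>\<^sub>v u) = r \<cdot>\<^sub>v h u"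
    if "h \<in> LinearCombinations.module_hom complex_field (R4 n) (R4 n)" "u \<in> carrier_vec (Suc n)"
    for h r u
    using that by (auto simp: LinearCombinations.module_hom_def R4_simps)
  have "f (cut j) = g (cut j)" if "j \<le> Suc n" for j
    using that
  proof (induction j)
    case 0
    have zero: "0 \<cdot>\<^sub>v u = 0\<^sub>v (Suc n)" if "u \<in> carrier_vec (Suc n)" for u :: "complex vec"
      using that by (auto intro!: eq_vecI)
    have "h (cut 0) = 0\<^sub>v (Suc n)"
      if h: "h \<in> LinearCombinations.module_hom complex_field (R4 n) (R4 n)" for h
    proof -
      have "h (cut 0) \<in> carrier_vec (Suc n)"
        using h car[of 0] by (auto simp: LinearCombinations.module_hom_def R4_carrier)
      moreover have "cut 0 = 0\<^sub>v (Suc n)" by (auto simp: cut_def)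
      ultimately show ?thesis
        using hom[OF h car[of 0], of 0] zero car[of 0] by simp
    qed
    then show ?case using f g by metis
  next
    case (Suc j)
    let ?e = "unit_vec (Suc n) j :: complex vec"
    have "cut (Suc j) = cut j + v $ j \<cdot>\<^sub>v ?e"
      using Suc.prems by (intro eq_vecI) (auto simp: cut_def unit_vec_def less_Suc_eq)
    then have "f (cut (Suc j)) = f (cut j) + v $ j \<cdot>\<^sub>v f ?e" "g (cut (Suc j)) = g (cut j) + v $ j \<cdot>\<^sub>v g ?e"
      using f g car[of j] by (auto simp: LinearCombinations.module_hom_def R4_simps)
    then show ?case using Suc eq by simp
  qed
  moreover have "cut (Suc n) = v" using v by (auto simp: cut_def)
  ultimately show ?thesis by (metis order_refl)
qed

lemma bilinear_eqI:
  assumes \<phi>: "bilinear_map (R4 n) \<phi>" and \<psi>: "bilinear_map (R4 n) \<psi>"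
    and eq: "\<And>i j. \<lbrakk>i \<le> n; j \<le> n\<rbrakk> \<Longrightarrow>
      \<phi> (unit_vec (Suc n) i, unit_vec (Suc n) j) = \<psi> (unit_vec (Suc n) i, unit_vec (Suc n) j)"
    and v: "v \<in> carrier_vec (Suc n)" and w: "w \<in> carrier_vec (Suc n)"
  shows "\<phi> (v, w) = \<psi> (v, w)"
proof -
  let ?e = "unit_vec (Suc n) :: nat \<Rightarrow> complex vec"
  have *: "\<phi> (v, ?e j) = \<psi> (v, ?e j)" if "j \<le> n" for j
    by (rule linear_eqI[where f = "\<lambda>v. \<phi> (v, ?e j)" and g = "\<lambda>v. \<psi> (v, ?e j)"])
      (use \<phi> \<psi> eq that v in \<open>auto simp: bilinear_map_def R4_carrier\<close>)
  show ?thesis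
    by (rule linear_eqI[where f = "\<lambda>w. \<phi> (v, w)" and g = "\<lambda>w. \<psi> (v, w)"])
      (use * \<phi> \<psi> v w in \<open>auto simp: bilinear_map_def R4_carrier\<close>)
qed

lemma matrix_hom_simps [simp]:
  "matrix_hom n f v \<in> carrier_vec (Suc n)"
  "dim_vec (matrix_hom n f v) = Suc n"
  "i \<le> n \<Longrightarrow> k \<le> n \<Longrightarrow> matrix_hom n f (unit_vec (Suc n) i) $ k = f (k, i)"
proof -
  assume "i \<le> n" "k \<le> n"
  have "f (k, j) * unit_vec (Suc n) i $ j = (if j = i then f (k, i) else 0)" if "j \<le> n" for j
    using that \<open>i \<le> n\<close> by auto
  then show "matrix_hom n f (unit_vec (Suc n) i) $ k = f (k, i)"
    using \<open>i \<le> n\<close> \<open>k \<le> n\<close> by (simp add: matrix_hom_def)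
qed (simp_all add: matrix_hom_def)

lemma matrix_hom_nth: "k \<le> n \<Longrightarrow> matrix_hom n f v $ k = (\<Sum>i\<le>n. f (k, i) * v $ i)"
  by (simp add: matrix_hom_def)

lemma matrix_hom_linear:
  "matrix_hom n f \<in> LinearCombinations.module_hom complex_field (R4 n) (R4 n)"
proof -
  have "matrix_hom n f (v + w) = matrix_hom n f v + matrix_hom n f w"
    if "v \<in> carrier_vec (Suc n)" "w \<in> carrier_vec (Suc n)" for v w
    using that by (intro eq_vecI) (simp_all add: matrix_hom_nth distrib_left sum.distrib)
  moreover have "matrix_hom n f (c \<cdot>\<^sub>v v) = c \<cdot>\<^sub>v matrix_hom n f v"
    if "v \<in> carrier_vec (Suc n)" for c v
    using that by (intro eq_vecI) (simp_all add: matrix_hom_nth sum_distrib_left mult.left_commute)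
  ultimately show ?thesis
    by (simp add: LinearCombinations.module_hom_def R4_simps)
qed

lemma bracket_closed [simp]:
  "bracket n v w \<in> carrier_vec (Suc n)" "dim_vec (bracket n v w) = Suc n"
  by (simp_all add: bracket_def bilinear_extension_def)

lemma bracket_bilinear: "bilinear_map (R4 n) (\<lambda>(v, w). bracket n v w)"
  unfolding bracket_def by (rule bilinear_extension_bilinear)

lemma bracket_nth:
  assumes "3 \<le> n" "k \<le> n"
  shows "bracket n v w $ k =
    (if k = 1 then v $ 1 * w $ 0 - v $ 0 * w $ 1 else 0) + (if k = n then v $ 1 * w $ 0 else 0) +
    (if k \<ge> 3 then v $ (k - 1) * w $ 1 else 0) + (if k \<ge> 2 then weight n k * v $ k * w $ 0 else 0) -
    (if k = n - 1 then v $ 0 * w $ 0 else 0)"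
  using R4_bracket_nth[OF assms] by (simp add: bracket_def weight_def)

lemma bracket_unit_vec:
  assumes n: "3 \<le> n"
  shows "v \<in> carrier_vec (Suc n) \<Longrightarrow> 2 \<le> j \<Longrightarrow> j \<le> n \<Longrightarrow> bracket n v (unit_vec (Suc n) j) = 0\<^sub>v (Suc n)"
    and "2 \<le> i \<Longrightarrow> i < n \<Longrightarrow> bracket n (unit_vec (Suc n) i) (unit_vec (Suc n) (Suc 0)) = unit_vec (Suc n) (Suc i)"
    and "bracket n (unit_vec (Suc n) n) (unit_vec (Suc n) (Suc 0)) = 0\<^sub>v (Suc n)"
    and "bracket n (unit_vec (Suc n) 0) (unit_vec (Suc n) (Suc 0)) = (- 1) \<cdot>\<^sub>v unit_vec (Suc n) (Suc 0)"
    and "bracket n (unit_vec (Suc n) (Suc 0)) (unit_vec (Suc n) (Suc 0)) = 0\<^sub>v (Suc n)"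
    and "bracket n (unit_vec (Suc n) (Suc 0)) (unit_vec (Suc n) 0) =
      unit_vec (Suc n) (Suc 0) + unit_vec (Suc n) n"
    and "2 \<le> i \<Longrightarrow> i \<le> n \<Longrightarrow>
      bracket n (unit_vec (Suc n) i) (unit_vec (Suc n) 0) = weight n i \<cdot>\<^sub>v unit_vec (Suc n) i"
    and "bracket n (unit_vec (Suc n) 0) (unit_vec (Suc n) 0) = (- 1) \<cdot>\<^sub>v unit_vec (Suc n) (n - 1)"
proof -
  show "v \<in> carrier_vec (Suc n) \<Longrightarrow> 2 \<le> j \<Longrightarrow> j \<le> n \<Longrightarrow> bracket n v (unit_vec (Suc n) j) = 0\<^sub>v (Suc n)"
    using n by (intro eq_vecI) (simp_all add: bracket_nth)
  show "2 \<le> i \<Longrightarrow> i < n \<Longrightarrow> bracket n (unit_vec (Suc n) i) (unit_vec (Suc n) (Suc 0)) = unit_vec (Suc n) (Suc i)"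
    using n by (intro eq_vecI) (auto simp: bracket_nth)
  show "bracket n (unit_vec (Suc n) n) (unit_vec (Suc n) (Suc 0)) = 0\<^sub>v (Suc n)"
    using n by (intro eq_vecI) (auto simp: bracket_nth)
  show "bracket n (unit_vec (Suc n) 0) (unit_vec (Suc n) (Suc 0)) = (- 1) \<cdot>\<^sub>v unit_vec (Suc n) (Suc 0)"
    using n by (intro eq_vecI) (auto simp: bracket_nth)
  show "bracket n (unit_vec (Suc n) (Suc 0)) (unit_vec (Suc n) (Suc 0)) = 0\<^sub>v (Suc n)"
    using n by (intro eq_vecI) (auto simp: bracket_nth)
  show "bracket n (unit_vec (Suc n) (Suc 0)) (unit_vec (Suc n) 0) =
      unit_vec (Suc n) (Suc 0) + unit_vec (Suc n) n"
    using n by (intro eq_vecI) (auto simp: bracket_nth)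
  show "2 \<le> i \<Longrightarrow> i \<le> n \<Longrightarrow>
      bracket n (unit_vec (Suc n) i) (unit_vec (Suc n) 0) = weight n i \<cdot>\<^sub>v unit_vec (Suc n) i"
    using n by (intro eq_vecI) (auto simp: bracket_nth)
  show "bracket n (unit_vec (Suc n) 0) (unit_vec (Suc n) 0) = (- 1) \<cdot>\<^sub>v unit_vec (Suc n) (n - 1)"
    using n by (intro eq_vecI) (auto simp: bracket_nth)
qed

lemma ZL2_R4_iff:
  "\<phi> \<in> carrier (ZL2 (R4 n)) \<longleftrightarrow>
    \<phi> \<in> extensional (carrier_vec (Suc n) \<times> carrier_vec (Suc n)) \<and> bilinear_map (R4 n) \<phi> \<and>
    (\<forall>x\<in>carrier_vec (Suc n). \<forall>y\<in>carrier_vec (Suc n). \<forall>z\<in>carrier_vec (Suc n).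
      bracket n x (\<phi> (y, z)) - bracket n (\<phi> (x, y)) z + bracket n (\<phi> (x, z)) y
      + \<phi> (x, bracket n y z) - \<phi> (bracket n x y, z) + \<phi> (bracket n x z, y) = 0\<^sub>v (Suc n))"
proof -
  have "bilinear_map (R4 n) \<phi> \<Longrightarrow> x \<in> carrier_vec (Suc n) \<Longrightarrow> y \<in> carrier_vec (Suc n) \<Longrightarrow>
     \<phi> (x, y) \<in> carrier_vec (Suc n)" for x y
    by (auto simp: bilinear_map_iff R4_carrier)
  then show ?thesis
    by (auto simp: ZL2_def bilinear_maps_simps R4_simps R4_a_minus bracket_def[symmetric]
        bracket_def[unfolded Suc_eq_plus1[symmetric], symmetric])
qed

lemma bilinear_R4:
  assumes "bilinear_map (R4 n) \<phi>" "x \<in> carrier_vec (Suc n)" "y \<in> carrier_vec (Suc n)"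
  shows "\<phi> (x, y) \<in> carrier_vec (Suc n)" "dim_vec (\<phi> (x, y)) = Suc n"
    "z \<in> carrier_vec (Suc n) \<Longrightarrow> \<phi> (x, y + z) = \<phi> (x, y) + \<phi> (x, z)"
    "z \<in> carrier_vec (Suc n) \<Longrightarrow> \<phi> (x + z, y) = \<phi> (x, y) + \<phi> (z, y)"
    "\<phi> (x, c \<cdot>\<^sub>v y) = c \<cdot>\<^sub>v \<phi> (x, y)" "\<phi> (c \<cdot>\<^sub>v x, y) = c \<cdot>\<^sub>v \<phi> (x, y)"
  using assms by (auto simp: bilinear_map_iff R4_simps)

lemma bilinear_R4_zero:
  assumes \<phi>: "bilinear_map (R4 n) \<phi>" and x: "x \<in> carrier_vec (Suc n)"
  shows "\<phi> (x, 0\<^sub>v (Suc n)) = 0\<^sub>v (Suc n)" "\<phi> (0\<^sub>v (Suc n), x) = 0\<^sub>v (Suc n)"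
proof -
  have 0: "0 \<cdot>\<^sub>v v = 0\<^sub>v (Suc n)" if "v \<in> carrier_vec (Suc n)" for v :: "complex vec"
    using that by (auto intro!: eq_vecI)
  note b = bilinear_R4[OF \<phi>, of x "0\<^sub>v (Suc n)"] bilinear_R4[OF \<phi>, of "0\<^sub>v (Suc n)" x]
  show "\<phi> (x, 0\<^sub>v (Suc n)) = 0\<^sub>v (Suc n)" "\<phi> (0\<^sub>v (Suc n), x) = 0\<^sub>v (Suc n)"
    using b(5)[of 0] b(12)[of 0] b(1) b(7) x 0 by simp_all
qed

lemma weight_eq_0_iff: "weight n k = 0 \<longleftrightarrow> Suc k = n"
proof -
  have "weight n k = of_nat (Suc k) - of_nat n" by (simp add: weight_def)
  then show ?thesis by (metis of_nat_eq_iff right_minus_eq)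
qed

section \<open>Cocycles are determined by their free entries\<close>

lemma smult_zero: "c \<cdot>\<^sub>v 0\<^sub>v m = (0\<^sub>v m :: complex vec)"
  by (auto intro!: eq_vecI)

text \<open>A cocycle on \<open>R\<^sub>4\<close> is determined by the entries compared here; the cocycle identity expresses
  the remaining ones through them.\<close>

definition same_free_entries :: "nat \<Rightarrow> (complex vec \<times> complex vec \<Rightarrow> complex vec) \<Rightarrow>
    (complex vec \<times> complex vec \<Rightarrow> complex vec) \<Rightarrow> bool" where
  "same_free_entries n \<phi> \<psi> \<longleftrightarrow> (let c = (\<lambda>\<theta> i j k. \<theta> (unit_vec (Suc n) i, unit_vec (Suc n) j) $ k :: complex) in
    (\<forall>j. 2 \<le> j \<longrightarrow> j \<le> n \<longrightarrow> c \<phi> 0 j 1 = c \<psi> 0 j 1 \<and> c \<phi> 1 j 1 = c \<psi> 1 j 1) \<and>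
    c \<phi> 1 0 0 = c \<psi> 1 0 0 \<and> c \<phi> 1 0 1 = c \<psi> 1 0 1 \<and>
    (\<forall>i k. 2 \<le> i \<longrightarrow> i \<le> n \<longrightarrow> 2 \<le> k \<longrightarrow> k \<le> n \<longrightarrow> k \<noteq> i \<or> i = 2 \<longrightarrow> c \<phi> i 0 k = c \<psi> i 0 k) \<and>
    (\<forall>i. 2 \<le> i \<longrightarrow> i < n \<longrightarrow> c \<phi> i 1 (Suc i) = c \<psi> i 1 (Suc i)) \<and>
    (\<forall>k. 2 \<le> k \<longrightarrow> k < n \<longrightarrow> c \<phi> 1 0 k = c \<psi> 1 0 k) \<and>
    (\<forall>k. 2 \<le> k \<longrightarrow> k \<le> n \<longrightarrow> c \<phi> 0 0 k = c \<psi> 0 0 k) \<and>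
    c \<phi> 0 1 n = c \<psi> 0 1 n)"

locale R4_cocycle =
  fixes n :: nat and \<phi> :: "complex vec \<times> complex vec \<Rightarrow> complex vec"
  assumes n: "3 \<le> n" and cocycle: "\<phi> \<in> carrier (ZL2 (R4 n))"
begin

abbreviation e :: "nat \<Rightarrow> complex vec" where "e \<equiv> unit_vec (Suc n)"

lemma bil: "bilinear_map (R4 n) \<phi>"
  using cocycle by (simp add: ZL2_R4_iff)

lemmas phi = bilinear_R4[OF bil] bilinear_R4_zero[OF bil]
lemmas br = bilinear_R4[OF bracket_bilinear[of n], simplified]

lemma cocycle_nth:
  assumes "x \<in> carrier_vec (Suc n)" "y \<in> carrier_vec (Suc n)" "z \<in> carrier_vec (Suc n)" "k \<le> n"
  shows "bracket n x (\<phi> (y, z)) $ k - bracket n (\<phi> (x, y)) z $ k + bracket n (\<phi> (x, z)) y $ k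
      + \<phi> (x, bracket n y z) $ k - \<phi> (bracket n x y, z) $ k + \<phi> (bracket n x z, y) $ k = 0"
proof -
  have "bracket n x (\<phi> (y, z)) - bracket n (\<phi> (x, y)) z + bracket n (\<phi> (x, z)) y
      + \<phi> (x, bracket n y z) - \<phi> (bracket n x y, z) + \<phi> (bracket n x z, y) = 0\<^sub>v (Suc n)"
    using cocycle assms by (simp add: ZL2_R4_iff)
  then have "(bracket n x (\<phi> (y, z)) - bracket n (\<phi> (x, y)) z + bracket n (\<phi> (x, z)) y
      + \<phi> (x, bracket n y z) - \<phi> (bracket n x y, z) + \<phi> (bracket n x z, y)) $ k = 0\<^sub>v (Suc n) $ k"
    by simp
  then show ?thesis
    using assms by (simp add: phi)
qed

text \<open>In the sum of the cocycle identities for \<open>(x, y, z)\<close> and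
  \<open>(x, z, y)\<close>, the four terms other than the first and the fourth cancel in
  pairs.\<close>

lemma cocycle_symmetrized:
  assumes "x \<in> carrier_vec (Suc n)" "y \<in> carrier_vec (Suc n)" "z \<in> carrier_vec (Suc n)"
  shows "bracket n x (\<phi> (y, z) + \<phi> (z, y)) + \<phi> (x, bracket n y z + bracket n z y) = 0\<^sub>v (Suc n)"
proof (rule eq_vecI)
  fix k assume "k < dim_vec (0\<^sub>v (Suc n) :: complex vec)"
  then have k: "k \<le> n" by simp
  have "(bracket n x (\<phi> (y, z) + \<phi> (z, y)) + \<phi> (x, bracket n y z + bracket n z y)) $ k =
    (bracket n x (\<phi> (y, z)) $ k - bracket n (\<phi> (x, y)) z $ k + bracket n (\<phi> (x, z)) y $ k
      + \<phi> (x, bracket n y z) $ k - \<phi> (bracket n x y, z) $ k + \<phi> (bracket n x z, y) $ k) +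
    (bracket n x (\<phi> (z, y)) $ k - bracket n (\<phi> (x, z)) y $ k + bracket n (\<phi> (x, y)) z $ k
      + \<phi> (x, bracket n z y) $ k - \<phi> (bracket n x z, y) $ k + \<phi> (bracket n x y, z) $ k)"
    using assms k by (simp add: phi br)
  also have "\<dots> = 0"
    unfolding cocycle_nth[OF assms k] cocycle_nth[OF assms(1,3,2) k] by simp
  finally show "(bracket n x (\<phi> (y, z) + \<phi> (z, y)) + \<phi> (x, bracket n y z + bracket n z y)) $ k =
    0\<^sub>v (Suc n) $ k"
    using k by simp
qed (use assms in \<open>simp add: phi\<close>)

lemma right_factor:
  assumes j: "2 \<le> j" "j \<le> n"
  obtains u where "u \<in> carrier_vec (Suc n)"
    and "\<And>x. x \<in> carrier_vec (Suc n) \<Longrightarrow> \<phi> (x, e j) = bracket n x u"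
proof -
  have e: "e i \<in> carrier_vec (Suc n)" for i by simp
  have *: "p = (- 1 / c) \<cdot>\<^sub>v q" if "q + c \<cdot>\<^sub>v p = 0\<^sub>v (Suc n)" "c \<noteq> 0"
    "p \<in> carrier_vec (Suc n)" "q \<in> carrier_vec (Suc n)" for p q :: "complex vec" and c
  proof (rule eq_vecI)
    fix k assume "k < dim_vec ((- 1 / c) \<cdot>\<^sub>v q)"
    then have k: "k < Suc n" using that by simp
    have "(q + c \<cdot>\<^sub>v p) $ k = 0\<^sub>v (Suc n) $ k" using that by simp
    then show "p $ k = ((- 1 / c) \<cdot>\<^sub>v q) $ k"
      using k that(2-) by (simp add: field_simps add_eq_0_iff)
  qed (use that in simp)
  \<comment> \<open>The pair \<open>(e j, e 0)\<close> gives the factor \<open>weight n j\<close>,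
    which vanishes exactly for \<open>j = n - 1\<close>; there \<open>[x,x]\<close> takes over with
    the factor -2.\<close>
  obtain y z c where yz: "y \<in> carrier_vec (Suc n)" "z \<in> carrier_vec (Suc n)"
    and c: "bracket n y z + bracket n z y = c \<cdot>\<^sub>v e j" "c \<noteq> 0"
  proof (cases "j = n - 1")
    case True
    have "(- 1) \<cdot>\<^sub>v e (n - 1) + (- 1) \<cdot>\<^sub>v e (n - 1) = (- 2) \<cdot>\<^sub>v e (n - 1)"
      by (intro eq_vecI) auto
    then show ?thesis
      using that[of "e 0" "e 0" "- 2"] True n by (simp add: bracket_unit_vec)
  next
    case False
    then have "weight n j \<noteq> 0" by (auto simp: weight_eq_0_iff)
    then show ?thesis
      using that[of "e j" "e 0" "weight n j"] j n by (simp add: bracket_unit_vec)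
  qed
  define u where "u = (- 1 / c) \<cdot>\<^sub>v (\<phi> (y, z) + \<phi> (z, y))"
  show thesis
  proof (rule that)
    show "u \<in> carrier_vec (Suc n)" using yz by (simp add: u_def phi)
    fix x :: "complex vec" assume x: "x \<in> carrier_vec (Suc n)"
    have "bracket n x (\<phi> (y, z) + \<phi> (z, y)) + c \<cdot>\<^sub>v \<phi> (x, e j) = 0\<^sub>v (Suc n)"
      using cocycle_symmetrized[OF x yz] c x by (simp add: phi)
    then have "\<phi> (x, e j) = (- 1 / c) \<cdot>\<^sub>v bracket n x (\<phi> (y, z) + \<phi> (z, y))"
      by (rule *) (use c x in \<open>simp_all add: phi\<close>)
    then show "\<phi> (x, e j) = bracket n x u"
      using x yz by (simp add: u_def br phi)
  qed
qed

text \<open>The vanishing spreads in three stages: first to \<open>\<phi> (x, e j)\<close> with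
  \<open>2 \<le> j\<close>, then to the coefficients of index 0 and 1 by symmetrization, finally to
  the coefficients of index at least 2 by the identity for \<open>(x, e 1, e 0)\<close>.\<close>

lemma eq_zero:
  assumes agree: "same_free_entries n \<phi> (\<lambda>_. 0\<^sub>v (Suc n))"
    and v: "v \<in> carrier_vec (Suc n)" and w: "w \<in> carrier_vec (Suc n)"
  shows "\<phi> (v, w) = 0\<^sub>v (Suc n)"
proof -
  define c where "c i j k = \<phi> (e i, e j) $ k" for i j k
  have e: "e i \<in> carrier_vec (Suc n)" for i by simp
  have "Suc 0 \<noteq> n - Suc 0" "n - Suc 0 \<noteq> Suc 0" "n \<noteq> 0" "n \<noteq> Suc 0" "n - Suc 0 \<noteq> 0" "0 \<noteq> n - Suc 0"
    using n by auto
  note n' = n this bracket_unit_vec[OF n]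
  note agree = agree[unfolded same_free_entries_def Let_def, simplified]
  have F1: "c 0 j (Suc 0) = 0" "c (Suc 0) j (Suc 0) = 0" if "2 \<le> j" "j \<le> n" for j
    using agree n that by (auto simp: c_def)
  have F2: "c (Suc 0) 0 0 = 0" "c (Suc 0) 0 (Suc 0) = 0" and F7: "c 0 (Suc 0) n = 0"
    using agree n by (auto simp: c_def)
  have F3: "c i 0 k = 0" if "2 \<le> i" "i \<le> n" "2 \<le> k" "k \<le> n" "k \<noteq> i \<or> i = 2" for i k
    using agree n that by (auto simp: c_def)
  have F4: "c i (Suc 0) (Suc i) = 0" if "2 \<le> i" "i < n" for i
    using agree n that by (auto simp: c_def)
  have F5: "c (Suc 0) 0 k = 0" if "2 \<le> k" "k < n" for k
    using agree n that by (auto simp: c_def)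
  have F6: "c 0 0 k = 0" if "2 \<le> k" "k \<le> n" for k
    using agree n that by (auto simp: c_def)
  have right: "\<phi> (x, e j) = 0\<^sub>v (Suc n)" if j: "2 \<le> j" "j \<le> n" and x: "x \<in> carrier_vec (Suc n)" for x j
  proof -
    obtain u where u: "u \<in> carrier_vec (Suc n)"
      "\<And>x. x \<in> carrier_vec (Suc n) \<Longrightarrow> \<phi> (x, e j) = bracket n x u"
      using right_factor[OF j] by blast
    \<comment> \<open>The bracket \<open>[x,u]\<close> depends only on these two coordinates of
      \<open>u\<close>; they are, up to sign, the coefficients of index 1 in \<open>[e 1, u]\<close>
      and \<open>[e 0, u]\<close>, which are free entries.\<close>
    have "u $ 0 = 0" "u $ Suc 0 = 0"
      using F1[OF j] u(2)[OF e, of 0] u(2)[OF e, of "Suc 0"] n' by (auto simp: c_def bracket_nth)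
    then show ?thesis
      using u(2)[OF x] n' by (auto simp: bracket_nth intro!: eq_vecI)
  qed
  \<comment> \<open>If the second term of the symmetrized identity vanishes, the sum of the two
    values is annihilated by every left multiplication, so it has no coefficient of index 0 or
    1.\<close>
  have sym: "\<phi> (y, z) $ 0 + \<phi> (z, y) $ 0 = 0" "\<phi> (y, z) $ Suc 0 + \<phi> (z, y) $ Suc 0 = 0"
    if yz: "y \<in> carrier_vec (Suc n)" "z \<in> carrier_vec (Suc n)"
      and 0: "\<And>x. x \<in> carrier_vec (Suc n) \<Longrightarrow> \<phi> (x, bracket n y z + bracket n z y) = 0\<^sub>v (Suc n)" for y z
  proof -
    define u where "u = \<phi> (y, z) + \<phi> (z, y)"
    have "bracket n (e i) u = 0\<^sub>v (Suc n)" for i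
      using cocycle_symmetrized[OF e yz, of i] 0[OF e, of i] yz by (simp add: u_def phi)
    then have "bracket n (e i) u $ Suc 0 = 0" for i
      using n by simp
    from this[of 0] this[of "Suc 0"] have "u $ 0 = 0" "u $ Suc 0 = 0"
      using n' by (auto simp: bracket_nth)
    then show "\<phi> (y, z) $ 0 + \<phi> (z, y) $ 0 = 0" "\<phi> (y, z) $ Suc 0 + \<phi> (z, y) $ Suc 0 = 0"
      using yz n by (auto simp: u_def phi)
  qed
  have low0: "c i 0 0 = 0" "c i 0 (Suc 0) = 0" if i: "2 \<le> i" "i \<le> n" for i
    using sym[of "e i" "e 0"] i n' right[OF i] by (simp_all add: c_def phi smult_zero)
  have low1: "c i (Suc 0) 0 = 0" "c i (Suc 0) (Suc 0) = 0" if i: "2 \<le> i" "i \<le> n" for i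
  proof -
    have "\<phi> (x, bracket n (e i) (e (Suc 0)) + bracket n (e (Suc 0)) (e i)) = 0\<^sub>v (Suc n)"
      if "x \<in> carrier_vec (Suc n)" for x
      using that i n' right by (cases "i = n") (simp_all add: phi)
    then show "c i (Suc 0) 0 = 0" "c i (Suc 0) (Suc 0) = 0"
      using sym[of "e i" "e (Suc 0)"] right[OF i] n by (simp_all add: c_def)
  qed
  have low00: "c 0 0 0 = 0" "c 0 0 (Suc 0) = 0"
  proof -
    have "\<phi> (x, bracket n (e 0) (e 0) + bracket n (e 0) (e 0)) = 0\<^sub>v (Suc n)"
      if "x \<in> carrier_vec (Suc n)" for x
      using that n' right[of "n - 1"] by (simp add: phi smult_zero)
    then show "c 0 0 0 = 0" "c 0 0 (Suc 0) = 0"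
      using sym[of "e 0" "e 0"] by (simp_all add: c_def)
  qed
  have low11: "c (Suc 0) (Suc 0) 0 = 0" "c (Suc 0) (Suc 0) (Suc 0) = 0"
    using sym[of "e (Suc 0)" "e (Suc 0)"] n' by (simp_all add: c_def phi)
  have low01: "c 0 (Suc 0) 0 = 0" "c 0 (Suc 0) (Suc 0) = 0"
  proof -
    have "(- 1) \<cdot>\<^sub>v e (Suc 0) + (e (Suc 0) + e n) = e n"
      by (auto intro!: eq_vecI)
    then have "\<phi> (x, bracket n (e 0) (e (Suc 0)) + bracket n (e (Suc 0)) (e 0)) = 0\<^sub>v (Suc n)"
      if "x \<in> carrier_vec (Suc n)" for x
      using that n' right[of n] by simp
    then show "c 0 (Suc 0) 0 = 0" "c 0 (Suc 0) (Suc 0) = 0"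
      using sym[of "e 0" "e (Suc 0)"] F2 by (simp_all add: c_def)
  qed
  \<comment> \<open>This is the cocycle identity for \<open>(x, e 1, e 0)\<close> in coordinate
    \<open>k\<close>. Its first term vanishes because \<open>\<phi> (e 1, e 0)\<close> has no
    coefficient of index 0 or 1, and \<open>[e 1, e 0] = e 1 + e n\<close> contributes only through
    \<open>e 1\<close>.\<close>
  have main: "(1 - weight n k) * \<phi> (x, e (Suc 0)) $ k
      + (if 3 \<le> k then \<phi> (x, e 0) $ (k - 1) else 0)
      - \<phi> (bracket n x (e (Suc 0)), e 0) $ k + \<phi> (bracket n x (e 0), e (Suc 0)) $ k = 0"
    if x: "x \<in> carrier_vec (Suc n)" "\<phi> (x, e (Suc 0)) $ 0 = 0" "\<phi> (x, e (Suc 0)) $ Suc 0 = 0"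
      and k: "2 \<le> k" "k \<le> n" for x k
  proof -
    have "bracket n x (\<phi> (e (Suc 0), e 0)) $ k = 0"
      using k n F2 by (simp add: bracket_nth c_def)
    moreover have "bracket n (\<phi> (x, e (Suc 0))) (e 0) $ k = weight n k * \<phi> (x, e (Suc 0)) $ k"
      using k n x by (simp add: bracket_nth)
    moreover have "bracket n (\<phi> (x, e 0)) (e (Suc 0)) $ k = (if 3 \<le> k then \<phi> (x, e 0) $ (k - 1) else 0)"
      using k n by (simp add: bracket_nth)
    moreover have "\<phi> (x, bracket n (e (Suc 0)) (e 0)) $ k = \<phi> (x, e (Suc 0)) $ k"
      using x k n right[of n x] by (simp add: bracket_unit_vec phi)
    ultimately show ?thesis
      using cocycle_nth[OF x(1) e e k(2), of "Suc 0" 0] by (simp add: algebra_simps)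
  qed
  have B: "(1 + weight n i - weight n k) * c i (Suc 0) k + (if 3 \<le> k then c i 0 (k - 1) else 0)
      - (if i < n then c (Suc i) 0 k else 0) = 0"
    if i: "2 \<le> i" "i \<le> n" and k: "2 \<le> k" "k \<le> n" for i k
  proof (cases "i = n")
    case True
    have "(1 - weight n k) * c i (Suc 0) k + (if 3 \<le> k then c i 0 (k - 1) else 0) + weight n i * c i (Suc 0) k = 0"
      using main[OF e, of i k] low1[OF i] i k n' True by (auto simp: phi c_def split: if_splits)
    then show ?thesis using True by (simp add: algebra_simps)
  next
    case False
    then have "(1 - weight n k) * c i (Suc 0) k + (if 3 \<le> k then c i 0 (k - 1) else 0)
        - c (Suc i) 0 k + weight n i * c i (Suc 0) k = 0"
      using main[OF e, of i k] low1[OF i] i k n' by (auto simp: phi c_def split: if_splits)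
    then show ?thesis using False i by (simp add: algebra_simps)
  qed
  \<comment> \<open>At \<open>k = i + 1\<close> the first coefficient in \<open>B\<close> is zero,
    so consecutive diagonal entries agree; the one with \<open>i = 2\<close> is free.\<close>
  have diag: "c i 0 i = 0" if "2 \<le> i" "i \<le> n" for i
    using that
  proof (induction i rule: dec_induct)
    case base
    then show ?case using F3 by simp
  next
    case (step i)
    then show ?case
      using B[of i "Suc i"] by (simp add: weight_def)
  qed
  have A0: "c i 0 k = 0" if "2 \<le> i" "i \<le> n" "k \<le> n" for i k
  proof -
    consider "k = 0" | "k = Suc 0" | "2 \<le> k" "k \<noteq> i" | "k = i" by linarith
    then show ?thesis
      using that low0[OF that(1,2)] F3[OF that(1,2)] diag[OF that(1,2)] by cases simp_all
  qed
  \<comment> \<open>With \<open>A0\<close> only the first term of \<open>B\<close> remains, with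
    factor \<open>i + 1 - k\<close>; the exceptional index \<open>k = i + 1\<close> is a free
    entry.\<close>
  have B0: "c i (Suc 0) k = 0" if i: "2 \<le> i" "i \<le> n" and k: "k \<le> n" for i k
  proof -
    consider "k = 0" | "k = Suc 0" | "2 \<le> k" "k \<noteq> Suc i" | "k = Suc i" by linarith
    then show ?thesis
    proof cases
      case 3
      have "(1 + weight n i - weight n k) * c i (Suc 0) k = 0"
        using B[OF i 3(1) k] A0 i k by (auto split: if_splits)
      moreover have "1 + weight n i - weight n k = of_nat (Suc i) - of_nat k"
        by (simp add: weight_def)
      then have "1 + weight n i - weight n k \<noteq> 0"
        using 3(2) by (metis of_nat_eq_iff right_minus_eq)
      ultimately show ?thesis by simp
    qed (use i k low1 F4 in auto)
  qed
  have x0: "c 0 0 k = 0" if "k \<le> n" for k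
  proof -
    consider "k = 0" | "k = Suc 0" | "2 \<le> k" by linarith
    then show ?thesis using low00 F6 that by cases auto
  qed
  \<comment> \<open>The factor equals \<open>n - k\<close>. At \<open>k = n\<close> the relation
    kills \<open>c 1 0 n\<close> and leaves \<open>c 0 1 n\<close> free; below \<open>n\<close> it
    determines \<open>c 0 1 k\<close> from the free entry \<open>c 1 0 k\<close>.\<close>
  have X: "(1 - weight n k) * c 0 (Suc 0) k + c (Suc 0) 0 k = 0" if k: "2 \<le> k" "k \<le> n" for k
    using main[OF e, of 0 k] low01 k n' x0[of "k - 1"] B0[of "n - 1" k]
    by (auto simp: phi c_def split: if_splits)
  have wt1: "1 - weight n k = of_nat n - of_nat k" for k by (simp add: weight_def)
  have x1: "c (Suc 0) 0 k = 0" if "k \<le> n" for k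
  proof -
    consider "k = 0" | "k = Suc 0" | "2 \<le> k" "k < n" | "k = n" using \<open>k \<le> n\<close> by linarith
    then show ?thesis using F2 F5 X[of n] n by cases (auto simp: wt1)
  qed
  have x2: "c 0 (Suc 0) k = 0" if "k \<le> n" for k
  proof -
    consider "k = 0" | "k = Suc 0" | "2 \<le> k" "k < n" | "k = n" using \<open>k \<le> n\<close> by linarith
    then show ?thesis using low01 F7 X[of k] x1[of k] by cases (auto simp: wt1)
  qed
  have x3: "c (Suc 0) (Suc 0) k = 0" if k: "k \<le> n" for k
  proof -
    consider "k = 0" | "k = Suc 0" | "2 \<le> k" by linarith
    then show ?thesis
    proof cases
      case 3
      \<comment> \<open>Taking \<open>x = e 1\<close> in \<open>main\<close>, the bracket
        \<open>[e 1, e 0]\<close> returns \<open>e 1\<close> once more; the total factor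
        \<open>n + 1 - k\<close> is never zero.\<close>
      have "(1 - weight n k) * c (Suc 0) (Suc 0) k + c (Suc 0) (Suc 0) k = 0"
        using main[OF e, of "Suc 0" k] low11 3 k n' x1[of "k - 1"] B0[of n k]
        by (auto simp: phi c_def split: if_splits)
      then have "(2 - weight n k) * c (Suc 0) (Suc 0) k = 0" by (simp add: algebra_simps)
      moreover have "2 - weight n k = of_nat (Suc n - k)"
        using k by (simp add: weight_def of_nat_diff)
      moreover have "of_nat (Suc n - k) \<noteq> (0 :: complex)"
        using k by (simp only: of_nat_eq_0_iff)
      ultimately show ?thesis by (metis mult_eq_0_iff)
    qed (use low11 in auto)
  qed
  have "\<phi> (e i, e j) = 0\<^sub>v (Suc n)" if i: "i \<le> n" and j: "j \<le> n" for i j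
  proof (rule eq_vecI)
    fix k assume "k < dim_vec (0\<^sub>v (Suc n) :: complex vec)"
    then have k: "k \<le> n" by simp
    consider "2 \<le> j" | "2 \<le> i" "j = 0" | "2 \<le> i" "j = Suc 0" | "i = 0" "j = 0" | "i = Suc 0" "j = 0"
      | "i = 0" "j = Suc 0" | "i = Suc 0" "j = Suc 0" by linarith
    then have "c i j k = 0"
      by cases (use i j k A0 B0 x0 x1 x2 x3 right[OF _ j e] in \<open>auto simp: c_def\<close>)
    then show "\<phi> (e i, e j) $ k = 0\<^sub>v (Suc n) $ k" using k by (simp add: c_def)
  qed (simp add: phi)
  moreover have "bilinear_map (R4 n) (\<lambda>_. 0\<^sub>v (Suc n))"
    by (auto simp: bilinear_map_iff R4_simps)
  ultimately show ?thesis
    using bilinear_eqI[OF bil, of "\<lambda>_. 0\<^sub>v (Suc n)"] v w by blast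
qed

end

section \<open>Coboundaries and one further cocycle\<close>

lemma ZL2_R4_vectorspace: "3 \<le> n \<Longrightarrow> vectorspace complex_field (ZL2 (R4 n))"
  using R4_leibniz leibniz_algebra.ZL2_vectorspace by blast

lemma ZL2_R4_ops:
  assumes "v \<in> carrier_vec (Suc n)" "w \<in> carrier_vec (Suc n)"
  shows "(\<phi> \<oplus>\<^bsub>ZL2 (R4 n)\<^esub> \<psi>) (v, w) = \<phi> (v, w) + \<psi> (v, w)"
    "(c \<odot>\<^bsub>ZL2 (R4 n)\<^esub> \<phi>) (v, w) = c \<cdot>\<^sub>v \<phi> (v, w)"
    "\<zero>\<^bsub>ZL2 (R4 n)\<^esub> (v, w) = 0\<^sub>v (Suc n)"
  using assms by (simp_all add: ZL2_simps bilinear_maps_simps R4_simps)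

lemma ZL2_R4_closed:
  assumes "\<phi> \<in> carrier (ZL2 (R4 n))" "v \<in> carrier_vec (Suc n)" "w \<in> carrier_vec (Suc n)"
  shows "\<phi> (v, w) \<in> carrier_vec (Suc n)" "dim_vec (\<phi> (v, w)) = Suc n"
  using assms bilinear_R4(1,2)[of n \<phi> v w] by (auto simp: ZL2_R4_iff)

lemma ZL2_R4_eqI:
  assumes \<phi>: "\<phi> \<in> carrier (ZL2 (R4 n))" and \<psi>: "\<psi> \<in> carrier (ZL2 (R4 n))"
    and eq: "\<And>v w. \<lbrakk>v \<in> carrier_vec (Suc n); w \<in> carrier_vec (Suc n)\<rbrakk> \<Longrightarrow> \<phi> (v, w) = \<psi> (v, w)"
  shows "\<phi> = \<psi>"
proof (rule extensionalityI)
  show "\<phi> \<in> extensional (carrier_vec (Suc n) \<times> carrier_vec (Suc n))"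
    "\<psi> \<in> extensional (carrier_vec (Suc n) \<times> carrier_vec (Suc n))"
    using \<phi> \<psi> by (auto simp: ZL2_R4_iff)
qed (use eq in auto)

text \<open>The difference is a cocycle whose free entries all vanish, so \<open>eq_zero\<close>
  applies to it.\<close>

lemma cocycle_eqI:
  assumes n: "3 \<le> n" and \<phi>: "\<phi> \<in> carrier (ZL2 (R4 n))" and \<psi>: "\<psi> \<in> carrier (ZL2 (R4 n))"
    and agree: "same_free_entries n \<phi> \<psi>"
  shows "\<phi> = \<psi>"
proof (rule ZL2_R4_eqI[OF \<phi> \<psi>])
  interpret Z: vectorspace complex_field "ZL2 (R4 n)" using n by (rule ZL2_R4_vectorspace)
  let ?Z = "ZL2 (R4 n)"
  define \<chi> where "\<chi> = \<phi> \<oplus>\<^bsub>?Z\<^esub> (- 1) \<odot>\<^bsub>?Z\<^esub> \<psi>"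
  have \<chi>: "\<chi> \<in> carrier ?Z"
    using \<phi> \<psi> Z.smult_closed[of "- 1" \<psi>] by (simp add: \<chi>_def)
  have \<chi>_nth: "\<chi> (v, w) $ k = \<phi> (v, w) $ k - \<psi> (v, w) $ k"
    if "v \<in> carrier_vec (Suc n)" "w \<in> carrier_vec (Suc n)" "k \<le> n" for v w k
    using that ZL2_R4_closed[OF \<phi> that(1,2)] ZL2_R4_closed[OF \<psi> that(1,2)]
    by (simp add: \<chi>_def ZL2_R4_ops)
  have "same_free_entries n \<chi> (\<lambda>_. 0\<^sub>v (Suc n))"
    using agree n by (simp add: same_free_entries_def Let_def \<chi>_nth)
  then have zero: "\<chi> (v, w) = 0\<^sub>v (Suc n)"
    if "v \<in> carrier_vec (Suc n)" "w \<in> carrier_vec (Suc n)" for v w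
    using that n \<chi> R4_cocycle.eq_zero[of n \<chi>] by (simp add: R4_cocycle_def)
  fix v w :: "complex vec"
  assume vw: "v \<in> carrier_vec (Suc n)" "w \<in> carrier_vec (Suc n)"
  show "\<phi> (v, w) = \<psi> (v, w)"
  proof (rule eq_vecI)
    fix k assume "k < dim_vec (\<psi> (v, w))"
    then have k: "k \<le> n" using ZL2_R4_closed[OF \<psi> vw] by simp
    then show "\<phi> (v, w) $ k = \<psi> (v, w) $ k"
      using \<chi>_nth[OF vw k] zero[OF vw] by simp
  qed (use ZL2_R4_closed[OF \<phi> vw] ZL2_R4_closed[OF \<psi> vw] in simp)
qed

lemma coboundary_R4:
  assumes d: "d \<in> LinearCombinations.module_hom complex_field (R4 n) (R4 n)"
    and vw: "v \<in> carrier_vec (Suc n)" "w \<in> carrier_vec (Suc n)"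
  shows "coboundary (R4 n) d (v, w) = bracket n (d v) w + bracket n v (d w) - d (bracket n v w)"
proof -
  have "d u \<in> carrier_vec (Suc n)" if "u \<in> carrier_vec (Suc n)" for u
    using d that by (auto simp: LinearCombinations.module_hom_def R4_carrier)
  then have "d (bracket n v w) \<in> carrier_vec (n + 1)" by simp
  then show ?thesis
    using vw by (simp add: coboundary_def R4_carrier R4_a_minus R4_simps(2,5) flip: bracket_def)
      (simp add: bracket_def R4_a_minus)
qed

lemma ideal_cocycle_nth:
  "\<lbrakk>v \<in> carrier_vec (Suc n); w \<in> carrier_vec (Suc n); k \<le> n\<rbrakk> \<Longrightarrow>
    ideal_cocycle n (v, w) $ k = (if 2 \<le> k then v $ k * w $ 0 else 0)"
  by (simp add: ideal_cocycle_def R4_carrier)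

text \<open>Values of \<open>\<sigma>\<close> lie in an ideal annihilated by all left
  multiplications, and brackets have no x-coordinate, so the first and fourth terms vanish. The
  other four cancel because \<open>\<sigma>([x,v],w) - [\<sigma>(x,w),v]\<close> is symmetric in
  \<open>v\<close> and \<open>w\<close>.\<close>

lemma ideal_cocycle_in_ZL2:
  assumes n: "3 \<le> n" shows "ideal_cocycle n \<in> carrier (ZL2 (R4 n))"
  unfolding ZL2_R4_iff
proof (intro conjI ballI)
  show "ideal_cocycle n \<in> extensional (carrier_vec (Suc n) \<times> carrier_vec (Suc n))"
    by (simp add: ideal_cocycle_def R4_carrier)
  show "bilinear_map (R4 n) (ideal_cocycle n)"
    unfolding bilinear_map_iff R4_carrier
    by (auto simp: ideal_cocycle_def R4_simps distrib_left distrib_right mult.left_commute mult.assoc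
        intro!: eq_vecI)
  fix x y z :: "complex vec"
  assume c: "x \<in> carrier_vec (Suc n)" "y \<in> carrier_vec (Suc n)" "z \<in> carrier_vec (Suc n)"
  let ?\<sigma> = "ideal_cocycle n"
  have d: "?\<sigma> (v, w) \<in> carrier_vec (Suc n)" if "v \<in> carrier_vec (Suc n)" "w \<in> carrier_vec (Suc n)" for v w
    using that by (simp add: ideal_cocycle_def R4_carrier)
  then have d': "dim_vec (?\<sigma> (v, w)) = Suc n"
    if "v \<in> carrier_vec (Suc n)" "w \<in> carrier_vec (Suc n)" for v w
    using that by auto
  show "bracket n x (?\<sigma> (y, z)) - bracket n (?\<sigma> (x, y)) z + bracket n (?\<sigma> (x, z)) y
      + ?\<sigma> (x, bracket n y z) - ?\<sigma> (bracket n x y, z) + ?\<sigma> (bracket n x z, y) = 0\<^sub>v (Suc n)"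
    (is "?E = _")
  proof (rule eq_vecI)
    fix k assume "k < dim_vec (0\<^sub>v (Suc n) :: complex vec)"
    then have k: "k \<le> n" by simp
    have n': "Suc 0 \<noteq> n - Suc 0" "n - Suc 0 \<noteq> Suc 0" "n \<noteq> 0" "n \<noteq> Suc 0" "n - Suc 0 \<noteq> 0"
      "0 \<noteq> n - Suc 0" using n by auto
    have "?E $ k = bracket n x (?\<sigma> (y, z)) $ k - bracket n (?\<sigma> (x, y)) z $ k + bracket n (?\<sigma> (x, z)) y $ k
      + ?\<sigma> (x, bracket n y z) $ k - ?\<sigma> (bracket n x y, z) $ k + ?\<sigma> (bracket n x z, y) $ k"
      using c k by (simp add: d')
    also have "\<dots> = 0"
    proof -
      have "bracket n x (?\<sigma> (y, z)) $ k = 0"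
        using c k n n' by (simp add: bracket_nth ideal_cocycle_nth)
      moreover have "?\<sigma> (x, bracket n y z) $ k = 0"
        using c k n n' by (simp add: bracket_nth ideal_cocycle_nth)
      \<comment> \<open>The difference sees only the part of \<open>x\<close> outside the ideal,
        whose products with \<open>v\<close> enter the ideal through \<open>e n\<close> in
        \<open>[e 1, e 0]\<close> and through \<open>[e 0, e 0]\<close>.\<close>
      moreover have "?\<sigma> (bracket n x v, w) $ k - bracket n (?\<sigma> (x, w)) v $ k =
          (if k = n then x $ 1 * v $ 0 * w $ 0 else 0) - (if k = n - 1 then x $ 0 * v $ 0 * w $ 0 else 0)"
        if "v \<in> carrier_vec (Suc n)" "w \<in> carrier_vec (Suc n)" for v w
        using c k n n' that by (cases "3 \<le> k") (auto simp: bracket_nth ideal_cocycle_nth algebra_simps)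
      from this[OF c(2,3)] this[OF c(3,2)]
      have "?\<sigma> (bracket n x y, z) $ k - bracket n (?\<sigma> (x, z)) y $ k =
          ?\<sigma> (bracket n x z, y) $ k - bracket n (?\<sigma> (x, y)) z $ k"
        by (simp add: mult.assoc mult.left_commute mult.commute)
      ultimately show ?thesis by (simp add: algebra_simps)
    qed
    finally show "?E $ k = 0\<^sub>v (Suc n) $ k" using k by simp
  qed (use c in \<open>simp add: d'\<close>)
qed

section \<open>Parametrization of the space of cocycles\<close>

text \<open>The index \<open>(Suc n, 0)\<close> lies outside the matrix and carries the coefficient of the extra cocycle.\<close>

definition cocycle_of :: "nat \<Rightarrow> (nat \<times> nat \<Rightarrow> complex) \<Rightarrow> complex vec \<times> complex vec \<Rightarrow> complex vec" where
  "cocycle_of n f = coboundary (R4 n) (matrix_hom n f) \<oplus>\<^bsub>ZL2 (R4 n)\<^esub>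
     f (Suc n, 0) \<odot>\<^bsub>ZL2 (R4 n)\<^esub> ideal_cocycle n"

lemma coboundary_matrix_hom_in_ZL2:
  "3 \<le> n \<Longrightarrow> coboundary (R4 n) (matrix_hom n f) \<in> carrier (ZL2 (R4 n))"
  using leibniz_algebra.coboundary_in_ZL2[OF R4_leibniz matrix_hom_linear] by blast

lemma cocycle_of_in_ZL2:
  assumes n: "3 \<le> n" shows "cocycle_of n f \<in> carrier (ZL2 (R4 n))"
proof -
  interpret Z: vectorspace complex_field "ZL2 (R4 n)" using n by (rule ZL2_R4_vectorspace)
  show ?thesis
    using ideal_cocycle_in_ZL2[OF n] coboundary_matrix_hom_in_ZL2[OF n]
      Z.smult_closed[of "f (Suc n, 0)" "ideal_cocycle n"] by (simp add: cocycle_of_def)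
qed

lemma cocycle_of_nth:
  assumes vw: "v \<in> carrier_vec (Suc n)" "w \<in> carrier_vec (Suc n)" and k: "k \<le> n"
  shows "cocycle_of n f (v, w) $ k =
    bracket n (matrix_hom n f v) w $ k + bracket n v (matrix_hom n f w) $ k
    - matrix_hom n f (bracket n v w) $ k + f (Suc n, 0) * (if 2 \<le> k then v $ k * w $ 0 else 0)"
proof -
  have "dim_vec (ideal_cocycle n (v, w)) = Suc n"
    using vw by (simp add: ideal_cocycle_def R4_carrier)
  then show ?thesis
    using vw k
    by (simp add: cocycle_of_def ZL2_R4_ops coboundary_R4[OF matrix_hom_linear] ideal_cocycle_nth)
qed

lemma cocycle_of_linear:
  assumes n: "3 \<le> n"
  shows "cocycle_of n (\<lambda>p. f p + g p) = cocycle_of n f \<oplus>\<^bsub>ZL2 (R4 n)\<^esub> cocycle_of n g"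
    and "cocycle_of n (\<lambda>p. c * f p) = c \<odot>\<^bsub>ZL2 (R4 n)\<^esub> cocycle_of n f"
proof -
  interpret Z: vectorspace complex_field "ZL2 (R4 n)" using n by (rule ZL2_R4_vectorspace)
  let ?Z = "ZL2 (R4 n)"
  note T = cocycle_of_in_ZL2[OF n]
  have sc: "c \<odot>\<^bsub>?Z\<^esub> cocycle_of n f \<in> carrier ?Z"
    using Z.smult_closed[of c "cocycle_of n f"] T by simp
  have M: "matrix_hom n (\<lambda>p. f p + g p) u = matrix_hom n f u + matrix_hom n g u"
    "matrix_hom n (\<lambda>p. c * f p) u = c \<cdot>\<^sub>v matrix_hom n f u" for u
    by (auto simp: matrix_hom_def distrib_right sum.distrib sum_distrib_left mult.assoc intro!: eq_vecI)
  note br = bilinear_R4[OF bracket_bilinear[of n], simplified]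
  note car = ZL2_R4_closed[OF T]
  show "cocycle_of n (\<lambda>p. f p + g p) = cocycle_of n f \<oplus>\<^bsub>?Z\<^esub> cocycle_of n g"
  proof (rule ZL2_R4_eqI[OF T])
    fix v w :: "complex vec"
    assume "v \<in> carrier_vec (Suc n)" "w \<in> carrier_vec (Suc n)"
    then show "cocycle_of n (\<lambda>p. f p + g p) (v, w) = (cocycle_of n f \<oplus>\<^bsub>?Z\<^esub> cocycle_of n g) (v, w)"
      by (intro eq_vecI) (simp_all add: car ZL2_R4_ops cocycle_of_nth M br algebra_simps)
  qed (use T in simp)
  show "cocycle_of n (\<lambda>p. c * f p) = c \<odot>\<^bsub>?Z\<^esub> cocycle_of n f"
  proof (rule ZL2_R4_eqI[OF T sc])
    fix v w :: "complex vec"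
    assume "v \<in> carrier_vec (Suc n)" "w \<in> carrier_vec (Suc n)"
    then show "cocycle_of n (\<lambda>p. c * f p) (v, w) = (c \<odot>\<^bsub>?Z\<^esub> cocycle_of n f) (v, w)"
      by (intro eq_vecI) (simp_all add: car ZL2_R4_ops cocycle_of_nth M br algebra_simps)
  qed
qed

text \<open>These are the entries compared by \<open>same_free_entries\<close>. Read as linear
  equations for \<open>f\<close>, they give both injectivity and surjectivity of the
  parametrization.\<close>

lemma cocycle_of_entries:
  fixes n f
  defines "e \<equiv> unit_vec (Suc n)" and "T \<equiv> cocycle_of n f"
  assumes n: "3 \<le> n"
  shows "2 \<le> j \<Longrightarrow> j \<le> n \<Longrightarrow> T (e 0, e j) $ Suc 0 = - f (Suc 0, j)"
    and "2 \<le> j \<Longrightarrow> j \<le> n \<Longrightarrow> T (e (Suc 0), e j) $ Suc 0 = f (0, j)"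
    and "T (e (Suc 0), e 0) $ 0 = - f (0, Suc 0) - f (0, n)"
    and "T (e (Suc 0), e 0) $ Suc 0 = f (0, 0) - f (Suc 0, n)"
    and "2 \<le> i \<Longrightarrow> i \<le> n \<Longrightarrow> 2 \<le> k \<Longrightarrow> k \<le> n \<Longrightarrow> T (e i, e 0) $ k =
      (of_nat k - of_nat i) * f (k, i) + (if k = n then f (Suc 0, i) else 0)
      - (if k = n - 1 then f (0, i) else 0) + (if k = i then weight n i * f (0, 0) + f (Suc n, 0) else 0)
      + (if k = Suc i then f (Suc 0, 0) else 0)"
    and "2 \<le> i \<Longrightarrow> i < n \<Longrightarrow>
      T (e i, e (Suc 0)) $ Suc i = f (i, i) - f (Suc i, Suc i) + f (Suc 0, Suc 0)"
    and "2 \<le> k \<Longrightarrow> k < n \<Longrightarrow> T (e (Suc 0), e 0) $ k =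
      (of_nat k - of_nat n) * f (k, Suc 0) - f (k, n) - (if k = n - 1 then f (0, Suc 0) else 0)"
    and "2 \<le> k \<Longrightarrow> k \<le> n \<Longrightarrow> T (e 0, e 0) $ k =
      weight n k * f (k, 0) + (if k = n then f (Suc 0, 0) else 0)
      - (if k = n - 1 then 2 * f (0, 0) else 0) + f (k, n - 1)"
    and "T (e 0, e (Suc 0)) $ n = f (n - 1, 0) + f (n, Suc 0)"
proof -
  have M: "matrix_hom n f (u + v) = matrix_hom n f u + matrix_hom n f v"
    if "u \<in> carrier_vec (Suc n)" "v \<in> carrier_vec (Suc n)" for u v
    using matrix_hom_linear[of n f] that by (auto simp: LinearCombinations.module_hom_def R4_simps)
  have Ms: "matrix_hom n f (c \<cdot>\<^sub>v u) = c \<cdot>\<^sub>v matrix_hom n f u" if "u \<in> carrier_vec (Suc n)" for u c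
    using matrix_hom_linear[of n f] that by (auto simp: LinearCombinations.module_hom_def R4_simps)
  have M0: "matrix_hom n f (0\<^sub>v (Suc n)) = 0\<^sub>v (Suc n)"
    by (auto simp: matrix_hom_def intro!: eq_vecI)
  have "Suc 0 \<noteq> n - Suc 0" "n - Suc 0 \<noteq> Suc 0" "n \<noteq> 0" "n \<noteq> Suc 0" "n - Suc 0 \<noteq> 0" "0 \<noteq> n - Suc 0"
    "n - Suc 0 \<noteq> n" "n \<noteq> n - Suc 0" "2 \<le> n" "Suc 0 \<le> n" "\<not> n \<le> Suc 0" "0 < n" "Suc 0 < n" "Suc 0 \<noteq> n"
    using n by auto
  note r = e_def T_def cocycle_of_nth bracket_nth[OF n] bracket_unit_vec[OF n] M Ms M0 n this
  show "2 \<le> j \<Longrightarrow> j \<le> n \<Longrightarrow> T (e 0, e j) $ Suc 0 = - f (Suc 0, j)"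
    by (simp add: r)
  show "2 \<le> j \<Longrightarrow> j \<le> n \<Longrightarrow> T (e (Suc 0), e j) $ Suc 0 = f (0, j)"
    by (simp add: r)
  show "T (e (Suc 0), e 0) $ 0 = - f (0, Suc 0) - f (0, n)"
    by (simp add: r)
  show "T (e (Suc 0), e 0) $ Suc 0 = f (0, 0) - f (Suc 0, n)"
    by (simp add: r)
  show "T (e i, e 0) $ k =
      (of_nat k - of_nat i) * f (k, i) + (if k = n then f (Suc 0, i) else 0)
      - (if k = n - 1 then f (0, i) else 0) + (if k = i then weight n i * f (0, 0) + f (Suc n, 0) else 0)
      + (if k = Suc i then f (Suc 0, 0) else 0)"
    if ik: "2 \<le> i" "i \<le> n" "2 \<le> k" "k \<le> n"
  proof -
    have "T (e i, e 0) $ k = bracket n (matrix_hom n f (e i)) (e 0) $ k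
        + bracket n (e i) (matrix_hom n f (e 0)) $ k - matrix_hom n f (bracket n (e i) (e 0)) $ k
        + (if k = i then f (Suc n, 0) else 0)"
      using ik by (simp add: e_def T_def cocycle_of_nth)
    also have "bracket n (matrix_hom n f (e i)) (e 0) $ k =
        weight n k * f (k, i) + (if k = n then f (Suc 0, i) else 0) - (if k = n - 1 then f (0, i) else 0)"
      using ik by (simp add: r)
    also have "bracket n (e i) (matrix_hom n f (e 0)) $ k =
        (if k = i then weight n i * f (0, 0) else 0) + (if k = Suc i then f (Suc 0, 0) else 0)"
    proof -
      have "e i $ 0 = 0" "e i $ Suc 0 = 0" "e i $ k = (if k = i then 1 else 0)"
        "3 \<le> k \<Longrightarrow> e i $ (k - Suc 0) = (if k = Suc i then 1 else 0)"
        using ik n by (auto simp: e_def)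
      moreover have "k = Suc i \<Longrightarrow> 3 \<le> k" using ik by simp
      moreover have "matrix_hom n f (e 0) $ 0 = f (0, 0)" "matrix_hom n f (e 0) $ Suc 0 = f (Suc 0, 0)"
        using n by (simp_all add: e_def)
      ultimately show ?thesis using ik by (cases "3 \<le> k") (auto simp: bracket_nth[OF n])
    qed
    also have "matrix_hom n f (bracket n (e i) (e 0)) $ k = weight n i * f (k, i)"
      using ik by (simp add: r)
    finally show ?thesis by (cases "k = i") (simp_all add: weight_def algebra_simps)
  qed
  show "2 \<le> i \<Longrightarrow> i < n \<Longrightarrow>
      T (e i, e (Suc 0)) $ Suc i = f (i, i) - f (Suc i, Suc i) + f (Suc 0, Suc 0)"
    by (auto simp: r)
  show "2 \<le> k \<Longrightarrow> k < n \<Longrightarrow> T (e (Suc 0), e 0) $ k =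
      (of_nat k - of_nat n) * f (k, Suc 0) - f (k, n) - (if k = n - 1 then f (0, Suc 0) else 0)"
    by (auto simp: r weight_def algebra_simps)
  show "2 \<le> k \<Longrightarrow> k \<le> n \<Longrightarrow> T (e 0, e 0) $ k =
      weight n k * f (k, 0) + (if k = n then f (Suc 0, 0) else 0)
      - (if k = n - 1 then 2 * f (0, 0) else 0) + f (k, n - 1)"
    by (auto simp: r)
  show "T (e 0, e (Suc 0)) $ n = f (n - 1, 0) + f (n, Suc 0)"
    by (simp add: r)
qed

text \<open>The three removed positions fix \<open>d\<close> modulo derivations and the added one is
  the coefficient of \<open>\<sigma>\<close>, for a total of \<open>(n + 1)^2 - 3 + 1\<close>
  parameters.\<close>

definition cocycle_indices :: "nat \<Rightarrow> (nat \<times> nat) set" where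
  "cocycle_indices n = insert (Suc n, 0) ({..n} \<times> {..n} - {(Suc 0, 0), (Suc 0, Suc 0), (n, Suc 0)})"

lemma card_cocycle_indices:
  assumes n: "3 \<le> n" shows "card (cocycle_indices n) = (n + 1)^2 - 2"
proof -
  let ?R = "{(Suc 0, 0), (Suc 0, Suc 0), (n, Suc 0)}"
  have "card ({..n} \<times> {..n} - ?R) = card ({..n} \<times> {..n}) - card ?R"
    using n by (intro card_Diff_subset) auto
  also have "card ?R = 3" using n by simp
  also have "card ({..n} \<times> {..n}) = (n + 1)^2"
    by (simp add: card_cartesian_product power2_eq_square)
  finally have "card (cocycle_indices n) = Suc ((n + 1)^2 - 3)"
    by (simp add: cocycle_indices_def)
  moreover have "(n + 1)^2 \<ge> 3" using n by (simp add: power2_eq_square)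
  ultimately show ?thesis by simp
qed

text \<open>The equations are triangular: rows 0 and 1 come first, then the off-diagonal entries and
  the coefficient of \<open>\<sigma>\<close>, then the diagonal, and finally columns 0 and
  1.\<close>

lemma cocycle_of_inj:
  assumes n: "3 \<le> n" and supp: "\<And>p. p \<notin> cocycle_indices n \<Longrightarrow> f p = 0"
    and zero: "cocycle_of n f = \<zero>\<^bsub>ZL2 (R4 n)\<^esub>"
  shows "f = (\<lambda>_. 0)"
proof -
  have T: "cocycle_of n f (unit_vec (Suc n) i, unit_vec (Suc n) j) $ k = 0" if "k \<le> n" for i j k
    using that by (simp add: zero ZL2_R4_ops)
  note E = cocycle_of_entries[OF n, where f = f]
  have s: "f (Suc 0, 0) = 0" "f (Suc 0, Suc 0) = 0" "f (n, Suc 0) = 0"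
    using n by (auto intro!: supp simp: cocycle_indices_def)
  have f1: "f (Suc 0, j) = 0" if "2 \<le> j" "j \<le> n" for j
    using E(1)[OF that] T[of "Suc 0" 0 j] n by simp
  have f0: "f (0, j) = 0" if "2 \<le> j" "j \<le> n" for j
    using E(2)[OF that] T[of "Suc 0" "Suc 0" j] n by simp
  have f01: "f (0, Suc 0) = 0"
    using E(3) T[of 0 "Suc 0" 0] f0[of n] n by simp
  have f00: "f (0, 0) = 0"
    using E(4) T[of "Suc 0" "Suc 0" 0] f1[of n] n by simp
  have off: "f (k, i) = 0" if "2 \<le> i" "i \<le> n" "2 \<le> k" "k \<le> n" "k \<noteq> i" for i k
    using E(5)[OF that(1-4)] T[OF that(4), of i 0] f0[OF that(1,2)] f1[OF that(1,2)] s that(5)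
    by (simp cong del: if_weak_cong)
  \<comment> \<open>For \<open>k = i\<close> the matrix entry \<open>f (i, i)\<close> drops out of
    the fifth equation, which isolates the coefficient of \<open>\<sigma>\<close>.\<close>
  have last: "f (Suc n, 0) = 0"
    using E(5)[of 2 2] T[of 2 2 0] f0[of 2] f1[of 2] f00 n by simp
  have step: "f (Suc i, Suc i) = f (i, i)" if "2 \<le> i" "i < n" for i
    using E(6)[OF that] T[of "Suc i" i "Suc 0"] s that by simp
  have const: "f (i, i) = f (2, 2)" if "2 \<le> i" "i \<le> n" for i
    using that by (induction i rule: dec_induct) (auto simp: step)
  \<comment> \<open>The diagonal is constant; its value is fixed where the weight vanishes, since
    there the eighth equation no longer contains \<open>f (n - 1, 0)\<close>. That entry is
    recovered below from the ninth equation.\<close>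
  have "2 \<le> n - 1" "n - 1 \<le> n" "weight n (n - 1) = 0" using n by (auto simp: weight_eq_0_iff)
  then have "f (n - 1, n - 1) = 0"
    using E(8)[of "n - 1"] T[of "n - 1" 0 0] f00 s by (simp cong del: if_weak_cong)
  then have diag: "f (i, i) = 0" if "2 \<le> i" "i \<le> n" for i
    using const[OF that] const[of "n - 1"] n by simp
  have f_0: "f (k, 0) = 0" if "2 \<le> k" "k \<le> n" for k
  proof (cases "k = n - 1")
    case True
    then show ?thesis using E(9) T[of n 0 "Suc 0"] s by simp
  next
    case False
    then have "weight n k \<noteq> 0" by (auto simp: weight_eq_0_iff)
    then show ?thesis using E(8)[OF that] T[OF that(2), of 0 0] False s off[of "n - 1" k] that n
      by (simp cong del: if_weak_cong)
  qed
  have f_1: "f (k, Suc 0) = 0" if "2 \<le> k" "k < n" for k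
    using E(7)[OF that] T[of k "Suc 0" 0] f01 off[of n k] that n
    by (simp cong del: if_weak_cong)
  have col0: "f (k, 0) = 0" if "k \<le> n" for k
  proof -
    consider "k = 0" | "k = Suc 0" | "2 \<le> k" by linarith
    then show ?thesis by cases (use that f00 s f_0 in auto)
  qed
  have col1: "f (k, Suc 0) = 0" if "k \<le> n" for k
  proof -
    consider "k = 0" | "k = Suc 0" | "2 \<le> k" "k < n" | "k = n" using \<open>k \<le> n\<close> by linarith
    then show ?thesis by cases (use s f01 f_1 in auto)
  qed
  have col: "f (k, i) = 0" if "2 \<le> i" "i \<le> n" "k \<le> n" for k i
  proof -
    consider "k = 0" | "k = Suc 0" | "k = i" | "2 \<le> k" "k \<noteq> i" by linarith
    then show ?thesis by cases (use that f0 f1 diag off in auto)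
  qed
  show ?thesis
  proof
    fix p :: "nat \<times> nat"
    obtain k i where p: "p = (k, i)" by (cases p)
    have "p \<notin> cocycle_indices n \<or> k = Suc n \<and> i = 0 \<or> k \<le> n \<and> i \<le> n"
      by (auto simp: cocycle_indices_def p)
    then consider "p \<notin> cocycle_indices n" | "k = Suc n" "i = 0" | "k \<le> n" "i \<le> n"
      by blast
    then show "f p = 0"
    proof cases
      case 3
      consider "i = 0" | "i = Suc 0" | "2 \<le> i" by linarith
      then show ?thesis
        by cases (use 3 p col0 col1 col in auto)
    qed (use supp last p in auto)
  qed
qed

text \<open>Solving the same triangular equations for \<open>f\<close> gives a parametrized cocycle
  with the free entries of \<open>\<phi>\<close>; uniqueness then identifies the two.\<close>

lemma cocycle_of_surj:
  assumes n: "3 \<le> n" and \<phi>: "\<phi> \<in> carrier (ZL2 (R4 n))"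
  shows "\<exists>f. (\<forall>p. p \<notin> cocycle_indices n \<longrightarrow> f p = 0) \<and> \<phi> = cocycle_of n f"
proof -
  define c where "c i j k = \<phi> (unit_vec (Suc n) i, unit_vec (Suc n) j) $ k" for i j k
  \<comment> \<open>Rows 0 and 1 are \<open>a0\<close> and \<open>a1\<close>; \<open>g0\<close> and
    \<open>h0\<close> are the top entries of columns 0 and 1, and \<open>g\<close> and
    \<open>h\<close> their lower parts; \<open>od\<close> and \<open>dg\<close> are the off-diagonal
    and diagonal entries of the remaining block, and \<open>\<kappa>\<close> is the coefficient of
    \<open>\<sigma>\<close>.\<close>
  define a0 where "a0 j = c (Suc 0) j (Suc 0)" for j
  define a1 where "a1 j = - c 0 j (Suc 0)" for j
  define h0 where "h0 = - c (Suc 0) 0 0 - a0 n"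
  define g0 where "g0 = c (Suc 0) 0 (Suc 0) + a1 n"
  define od where "od k i = (c i 0 k - (if k = n then a1 i else 0) + (if k = n - 1 then a0 i else 0))
    / (of_nat k - of_nat i)" for k i
  define \<kappa> where "\<kappa> = c 2 0 2 - weight n 2 * g0 + (if n = 3 then a0 2 else 0)"
  \<comment> \<open>The partial sums make \<open>dg i - dg (i + 1)\<close> equal to the required
    entry; the constant in \<open>dg\<close> is chosen to match the entry of
    \<open>\<phi> (e 0, e 0)\<close> at \<open>n - 1\<close>.\<close>
  define S where "S i = (\<Sum>j=2..<i. c j (Suc 0) (Suc j))" for i
  define dg where "dg i = c 0 0 (n - 1) + 2 * g0 + S (n - 1) - S i" for i
  define h where "h k = (c (Suc 0) 0 k + od k n + (if k = n - 1 then h0 else 0)) / (of_nat k - of_nat n)" for k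
  define g where "g k = (if k = n - 1 then c 0 (Suc 0) n else (c 0 0 k - od k (n - 1)) / weight n k)" for k
  define f where "f = (\<lambda>(k, i). if k = Suc n \<and> i = 0 then \<kappa> else if n < k \<or> n < i then 0
    else if 2 \<le> i then (if k = 0 then a0 i else if k = Suc 0 then a1 i else if k = i then dg i else od k i)
    else if i = Suc 0 then (if k = 0 then h0 else if k = Suc 0 \<or> k = n then 0 else h k)
    else (if k = 0 then g0 else if k = Suc 0 then 0 else g k))"
  have supp: "f p = 0" if "p \<notin> cocycle_indices n" for p
  proof -
    obtain k i where p: "p = (k, i)" by force
    have 1: "\<not> (k = Suc n \<and> i = 0)"
      and 2: "n < k \<or> n < i \<or> (k = Suc 0 \<and> i = 0) \<or> (k = Suc 0 \<and> i = Suc 0) \<or> (k = n \<and> i = Suc 0)"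
      using that by (auto simp: p cocycle_indices_def)
    from 2 show ?thesis
      by (elim disjE) (use 1 n in \<open>auto simp: p f_def\<close>)
  qed
  note E = cocycle_of_entries[OF n, where f = f]
  have od: "(of_nat k - of_nat i) * od k i =
      c i 0 k - (if k = n then a1 i else 0) + (if k = n - 1 then a0 i else 0)" if "k \<noteq> i" for k i
    using that by (simp add: od_def)
  have S: "S (Suc i) = S i + c i (Suc 0) (Suc i)" if "2 \<le> i" for i
    using that by (simp add: S_def)
  have "same_free_entries n \<phi> (cocycle_of n f)"
    unfolding same_free_entries_def Let_def c_def[symmetric] One_nat_def
  proof (intro conjI allI impI)
    fix j assume "2 \<le> j" "j \<le> n"
    show "c 0 j (Suc 0) = cocycle_of n f (unit_vec (Suc n) 0, unit_vec (Suc n) j) $ Suc 0"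
      "c (Suc 0) j (Suc 0) = cocycle_of n f (unit_vec (Suc n) (Suc 0), unit_vec (Suc n) j) $ Suc 0"
      unfolding E(1)[OF \<open>2 \<le> j\<close> \<open>j \<le> n\<close>] E(2)[OF \<open>2 \<le> j\<close> \<open>j \<le> n\<close>]
      using \<open>2 \<le> j\<close> \<open>j \<le> n\<close> by (simp_all add: f_def a0_def a1_def)
  next
    show "c (Suc 0) 0 0 = cocycle_of n f (unit_vec (Suc n) (Suc 0), unit_vec (Suc n) 0) $ 0"
      "c (Suc 0) 0 (Suc 0) = cocycle_of n f (unit_vec (Suc n) (Suc 0), unit_vec (Suc n) 0) $ Suc 0"
      "c 0 (Suc 0) n = cocycle_of n f (unit_vec (Suc n) 0, unit_vec (Suc n) (Suc 0)) $ n"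
      unfolding E(3,4,9) using n by (auto simp: f_def h0_def g0_def g_def)
  next
    fix i k assume ik: "2 \<le> i" "i \<le> n" "2 \<le> k" "k \<le> n" "k \<noteq> i \<or> i = 2"
    show "c i 0 k = cocycle_of n f (unit_vec (Suc n) i, unit_vec (Suc n) 0) $ k"
    proof (cases "k = i")
      case True
      then have "i = 2" using ik by simp
      then show ?thesis
        unfolding E(5)[OF ik(1-4)] using True n by (auto simp: f_def \<kappa>_def)
    next
      case False
      have "f (k, i) = od k i" using False ik by (simp add: f_def)
      then show ?thesis
        unfolding E(5)[OF ik(1-4)] using False ik n by (simp add: od) (simp add: f_def)
    qed
  next
    fix i assume i: "2 \<le> i" "i < n"
    show "c i (Suc 0) (Suc i) = cocycle_of n f (unit_vec (Suc n) i, unit_vec (Suc n) (Suc 0)) $ Suc i"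
      unfolding E(6)[OF i] using i n by (simp add: f_def dg_def S)
  next
    fix k assume k: "2 \<le> k" "k < n"
    then have "f (k, n) = od k n" "f (k, Suc 0) = h k" "f (0, Suc 0) = h0"
      by (simp_all add: f_def)
    then show "c (Suc 0) 0 k = cocycle_of n f (unit_vec (Suc n) (Suc 0), unit_vec (Suc n) 0) $ k"
      unfolding E(7)[OF k] using k by (simp add: h_def)
  next
    fix k assume k: "2 \<le> k" "k \<le> n"
    have *: "f (k, 0) = g k" "f (0, 0) = g0" "f (Suc 0, 0) = 0"
      using k by (simp_all add: f_def)
    show "c 0 0 k = cocycle_of n f (unit_vec (Suc n) 0, unit_vec (Suc n) 0) $ k"
    proof (cases "k = n - 1")
      case True
      then have "weight n k = 0" "f (k, n - 1) = dg (n - 1)"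
        using k n by (auto simp: weight_eq_0_iff f_def)
      then show ?thesis
        unfolding E(8)[OF k] using True k n by (simp add: * dg_def)
    next
      case False
      then have "weight n k \<noteq> 0" "f (k, n - 1) = od k (n - 1)"
        using k n by (auto simp: weight_eq_0_iff f_def)
      then show ?thesis
        unfolding E(8)[OF k] using False k n by (simp add: * g_def)
    qed
  qed
  then have "\<phi> = cocycle_of n f"
    using cocycle_eqI[OF n \<phi> cocycle_of_in_ZL2[OF n]] by blast
  then show ?thesis using supp by blast
qed

section \<open>A linear functional whose kernel is the space of coboundaries\<close>

text \<open>The last term corrects the case \<open>n = 3\<close>, where \<open>[x,x] = - e\<^sub>2\<close>.\<close>

definition obstruction :: "nat \<Rightarrow> (complex vec \<times> complex vec \<Rightarrow> complex vec) \<Rightarrow> complex" where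
  "obstruction n \<phi> = (let c = (\<lambda>i j k. \<phi> (unit_vec (Suc n) i, unit_vec (Suc n) j) $ k) in
    c 2 0 2 - weight n 2 * (c (Suc 0) 0 (Suc 0) - c 0 n (Suc 0)) + (if n = 3 then c (Suc 0) 2 (Suc 0) else 0))"

text \<open>The entry at \<open>i = k = 2\<close> contains the coefficient of
  \<open>\<sigma>\<close> plus \<open>weight n 2 * f (0, 0)\<close>, and for \<open>n = 3\<close>
  also \<open>- f (0, 2)\<close>. Both extra terms are recovered from other entries and
  removed.\<close>

lemma obstruction_cocycle_of:
  assumes n: "3 \<le> n" shows "obstruction n (cocycle_of n f) = f (Suc n, 0)"
proof -
  note E = cocycle_of_entries[OF n, where f = f]
  have "cocycle_of n f (unit_vec (Suc n) 2, unit_vec (Suc n) 0) $ 2 =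
      weight n 2 * f (0, 0) + f (Suc n, 0) - (if n = 3 then f (0, 2) else 0)"
    using E(5)[of 2 2] n by auto
  moreover have "cocycle_of n f (unit_vec (Suc n) 0, unit_vec (Suc n) n) $ Suc 0 = - f (Suc 0, n)"
    "cocycle_of n f (unit_vec (Suc n) (Suc 0), unit_vec (Suc n) 2) $ Suc 0 = f (0, 2)"
    using E(1)[of n] E(2)[of 2] n by simp_all
  ultimately show ?thesis
    unfolding obstruction_def Let_def E(4) by (simp cong del: if_weak_cong)
qed

lemma obstruction_linear:
  assumes n: "3 \<le> n" and \<phi>: "\<phi> \<in> carrier (ZL2 (R4 n))"
  shows "\<psi> \<in> carrier (ZL2 (R4 n)) \<Longrightarrow>
      obstruction n (\<phi> \<oplus>\<^bsub>ZL2 (R4 n)\<^esub> \<psi>) = obstruction n \<phi> + obstruction n \<psi>"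
    and "obstruction n (c \<odot>\<^bsub>ZL2 (R4 n)\<^esub> \<phi>) = c * obstruction n \<phi>"
proof -
  let ?e = "unit_vec (Suc n) :: nat \<Rightarrow> complex vec"
  show "obstruction n (\<phi> \<oplus>\<^bsub>ZL2 (R4 n)\<^esub> \<psi>) = obstruction n \<phi> + obstruction n \<psi>"
    if \<psi>: "\<psi> \<in> carrier (ZL2 (R4 n))"
  proof -
    have "(\<phi> \<oplus>\<^bsub>ZL2 (R4 n)\<^esub> \<psi>) (?e i, ?e j) $ k = \<phi> (?e i, ?e j) $ k + \<psi> (?e i, ?e j) $ k"
      if "k \<le> n" for i j k
      using that by (simp add: ZL2_R4_ops ZL2_R4_closed(2)[OF \<phi>] ZL2_R4_closed(2)[OF \<psi>])
    then show ?thesis using n by (simp add: obstruction_def Let_def algebra_simps cong del: if_weak_cong)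
  qed
  have "(c \<odot>\<^bsub>ZL2 (R4 n)\<^esub> \<phi>) (?e i, ?e j) $ k = c * \<phi> (?e i, ?e j) $ k" if "k \<le> n" for i j k
    using that by (simp add: ZL2_R4_ops ZL2_R4_closed(2)[OF \<phi>])
  then show "obstruction n (c \<odot>\<^bsub>ZL2 (R4 n)\<^esub> \<phi>) = c * obstruction n \<phi>"
    using n by (simp add: obstruction_def Let_def algebra_simps cong del: if_weak_cong)
qed

lemma cocycle_of_eq_coboundary:
  assumes n: "3 \<le> n" and f: "f (Suc n, 0) = 0"
  shows "cocycle_of n f = coboundary (R4 n) (matrix_hom n f)"
proof -
  interpret Z: vectorspace complex_field "ZL2 (R4 n)" using n by (rule ZL2_R4_vectorspace)
  show ?thesis
    using ideal_cocycle_in_ZL2[OF n] coboundary_matrix_hom_in_ZL2[OF n] Z.smult_l_null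
    by (simp add: cocycle_of_def f)
qed

lemma BL2_iff_obstruction:
  assumes n: "3 \<le> n" and \<phi>: "\<phi> \<in> carrier (ZL2 (R4 n))"
  shows "\<phi> \<in> BL2 (R4 n) \<longleftrightarrow> obstruction n \<phi> = 0"
proof
  assume "\<phi> \<in> BL2 (R4 n)"
  then obtain d where d: "d \<in> LinearCombinations.module_hom complex_field (R4 n) (R4 n)"
    and \<phi>: "\<phi> = coboundary (R4 n) d" by (auto simp: BL2_def)
  \<comment> \<open>The matrix of \<open>d\<close>; the default zero below the last row sets the
    coefficient of \<open>\<sigma>\<close> to zero.\<close>
  define f where "f = (\<lambda>(k, i). if k \<le> n then d (unit_vec (Suc n) i) $ k else 0)"
  have "d (unit_vec (Suc n) i) \<in> carrier_vec (Suc n)" for i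
    using d by (auto simp: LinearCombinations.module_hom_def R4_carrier)
  then have "d v = matrix_hom n f v" if "v \<in> carrier_vec (Suc n)" for v
    by (intro linear_eqI[OF d matrix_hom_linear _ that] eq_vecI) (auto simp: f_def)
  then have eq: "\<phi> (v, w) = coboundary (R4 n) (matrix_hom n f) (v, w)"
    if "v \<in> carrier_vec (Suc n)" "w \<in> carrier_vec (Suc n)" for v w
    using that by (simp add: \<phi> coboundary_R4[OF d] coboundary_R4[OF matrix_hom_linear])
  have "\<phi> = coboundary (R4 n) (matrix_hom n f)"
    by (rule ZL2_R4_eqI[OF assms(2) coboundary_matrix_hom_in_ZL2[OF n]]) (simp add: eq)
  also have "\<dots> = cocycle_of n f"
    using n by (simp add: cocycle_of_eq_coboundary f_def)
  finally show "obstruction n \<phi> = 0"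
    using n by (simp add: obstruction_cocycle_of f_def)
next
  assume 0: "obstruction n \<phi> = 0"
  obtain f where f: "\<phi> = cocycle_of n f" using cocycle_of_surj[OF n \<phi>] by blast
  then have "\<phi> = coboundary (R4 n) (matrix_hom n f)"
    using 0 n by (simp add: obstruction_cocycle_of cocycle_of_eq_coboundary)
  then show "\<phi> \<in> BL2 (R4 n)"
    using matrix_hom_linear by (auto simp: BL2_def)
qed

section \<open>The cocycle \<open>rho\<close> and its class\<close>

lemma bilinear_extension_unit_vec:
  assumes "i < m" "j < m" "k < m"
  shows "bilinear_extension m t (unit_vec m i) (unit_vec m j) $ k = t i j $ k"
proof -
  have "(\<Sum>b<m. unit_vec m i $ a * unit_vec m j $ b * t a b $ k) = (if a = i then t i j $ k else 0)"
    if "a < m" for a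
  proof -
    have "(\<Sum>b<m. unit_vec m i $ a * unit_vec m j $ b * t a b $ k) =
        (\<Sum>b<m. if b = j then unit_vec m i $ a * t a j $ k else 0)"
      using assms by (intro sum.cong) auto
    then show ?thesis using assms that by simp
  qed
  then show ?thesis
    using assms by (simp add: bilinear_extension_def)
qed

text \<open>The map \<open>d\<close> kills \<open>e 1\<close> and fixes the other basis vectors. Its
  coboundary sends \<open>(e i, e 0)\<close> with \<open>2 \<le> i\<close> to
  \<open>(i + 1 - n)\<close> times \<open>e i\<close>, and adding \<open>n - 3\<close> times
  \<open>\<sigma>\<close> turns this factor into \<open>i - 2\<close>.\<close>

lemma rho_eq_cocycle_of:
  assumes n: "3 \<le> n"
  shows "rho n = cocycle_of n
    (\<lambda>(k, i). if k = Suc n \<and> i = 0 then of_nat n - 3 else if k = i \<and> k \<noteq> Suc 0 then 1 else 0)"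
proof -
  define f :: "nat \<times> nat \<Rightarrow> complex" where
    "f = (\<lambda>(k, i). if k = Suc n \<and> i = 0 then of_nat n - 3 else if k = i \<and> k \<noteq> Suc 0 then 1 else 0)"
  have T: "cocycle_of n f \<in> carrier (ZL2 (R4 n))" using n by (rule cocycle_of_in_ZL2)
  let ?e = "unit_vec (Suc n) :: nat \<Rightarrow> complex vec"
  have f: "f (k, i) = (if i = k \<and> k \<noteq> Suc 0 then 1 else 0)" if "k \<le> n" for k i
    using that by (simp add: f_def)
  have M: "matrix_hom n f v $ k = (if k = Suc 0 then 0 else v $ k)" if "k \<le> n" for v k
  proof -
    have "f (k, i) * v $ i = (if i = k then if k = Suc 0 then 0 else v $ k else 0)" for i
      using that by (simp add: f)
    then show ?thesis using that by (simp add: matrix_hom_nth)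
  qed
  have Me: "matrix_hom n f (?e i) = (if i = Suc 0 then 0\<^sub>v (Suc n) else ?e i)" if "i \<le> n" for i
    using that by (intro eq_vecI) (auto simp: M f)
  have eq: "bilinear_extension (n + 1) (rho_values n) (?e i) (?e j) = cocycle_of n f (?e i, ?e j)"
    if ij: "i \<le> n" "j \<le> n" for i j
  proof (rule eq_vecI)
    fix k assume "k < dim_vec (cocycle_of n f (?e i, ?e j))"
    then have k: "k \<le> n" by (simp add: ZL2_R4_closed(2)[OF T])
    define b where "b = bracket n (?e i) (?e j) $ k"
    \<comment> \<open>As \<open>d\<close> is diagonal with entries 0 and 1, each of the three
      coboundary terms is either the bracket coefficient \<open>b\<close> or zero.\<close>
    have "cocycle_of n f (?e i, ?e j) $ k = (if i = Suc 0 then 0 else b) + (if j = Suc 0 then 0 else b)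
        - (if k = Suc 0 then 0 else b) + (of_nat n - 3) * (if 2 \<le> k \<and> k = i \<and> j = 0 then 1 else 0)"
    proof -
      have "f (Suc n, 0) = of_nat n - 3" by (simp add: f_def)
      then show ?thesis
        using ij k bilinear_R4_zero[OF bracket_bilinear[of n]]
        by (simp add: cocycle_of_nth M Me b_def)
    qed
    also have "\<dots> = rho_values n i j $ k"
    proof -
      have n': "Suc 0 \<noteq> n - Suc 0" "n - Suc 0 \<noteq> Suc 0" "n \<noteq> 0" "n \<noteq> Suc 0" "Suc 0 \<noteq> n" "n - Suc 0 \<noteq> 0"
        "0 \<noteq> n - Suc 0" "n - Suc 0 \<noteq> n" "n \<noteq> n - Suc 0" "0 < n" "Suc 0 < n" using n by auto
      note v = b_def bracket_unit_vec[OF n] rho_values_def Let_def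
      consider "2 \<le> j" | "j = 0" | "j = Suc 0" by linarith
      then show ?thesis
      proof cases
        case 1
        then show ?thesis using ij k by (simp add: v)
      next
        case 2
        consider "i = 0" | "i = Suc 0" | "i = 2" | "3 \<le> i" by linarith
        then show ?thesis by cases (use 2 ij k in \<open>auto simp: v weight_def n'\<close>)
      next
        case 3
        consider "i = 0" | "i = Suc 0" | "2 \<le> i" "i < n" | "i = n" using ij by linarith
        then show ?thesis by cases (use 3 ij k in \<open>auto simp: v n'\<close>)
      qed
    qed
    finally show "bilinear_extension (n + 1) (rho_values n) (?e i) (?e j) $ k = cocycle_of n f (?e i, ?e j) $ k"
      using bilinear_extension_unit_vec[of i "n + 1" j k] ij k by simp
  qed (simp add: bilinear_extension_def ZL2_R4_closed(2)[OF T])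
  have "rho n = cocycle_of n f"
  proof (rule extensionalityI)
    show "rho n \<in> extensional (carrier_vec (Suc n) \<times> carrier_vec (Suc n))"
      by (simp add: rho_def R4_carrier)
    show "cocycle_of n f \<in> extensional (carrier_vec (Suc n) \<times> carrier_vec (Suc n))"
      using T by (simp add: ZL2_R4_iff)
    fix p :: "complex vec \<times> complex vec"
    assume "p \<in> carrier_vec (Suc n) \<times> carrier_vec (Suc n)"
    then obtain v w where p: "p = (v, w)" "v \<in> carrier_vec (Suc n)" "w \<in> carrier_vec (Suc n)" by auto
    have "bilinear_map (R4 n) (cocycle_of n f)" using T by (simp add: ZL2_R4_iff)
    then have "(\<lambda>(v, w). bilinear_extension (n + 1) (rho_values n) v w) (v, w) = cocycle_of n f (v, w)"
      by (rule bilinear_eqI[OF bilinear_extension_bilinear]) (use eq p in auto)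
    then show "rho n p = cocycle_of n f p"
      using p by (simp add: rho_def R4_carrier)
  qed
  then show ?thesis unfolding f_def .
qed

text \<open>The basis claim is restricted to \<open>n \<ge> 4\<close> because \<open>rho\<close> is
  a coboundary for \<open>n = 3\<close>, as \<open>class_rho_R4_3\<close> records; the dimension
  formulas hold there too.\<close>

theorem corollary3p13:
  fixes n :: nat
  assumes "n \<ge> 3"
  shows "vectorspace.fin_dim complex_field (ZL2 (R4 n)) \<and>
         vectorspace.dim complex_field (ZL2 (R4 n)) = (n + 1)^2 - 2 \<and>
         vectorspace.fin_dim complex_field (HL2 (R4 n)) \<and>
         vectorspace.dim complex_field (HL2 (R4 n)) = 1 \<and>
         (n \<ge> 4 \<longrightarrow>
           vectorspace.basis complex_field (HL2 (R4 n)) {HL2_class (R4 n) (rho n)})"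
proof -
  note Z = ZL2_R4_vectorspace[OF assms]
  have Z_dim: "vectorspace.fin_dim complex_field (ZL2 (R4 n)) \<and>
      vectorspace.dim complex_field (ZL2 (R4 n)) = (n + 1)^2 - 2"
    unfolding card_cocycle_indices[OF assms, symmetric]
    using Z
  proof (rule dim_eq_card)
    show "finite (cocycle_indices n)" by (simp add: cocycle_indices_def)
  qed (fact cocycle_of_in_ZL2[OF assms] cocycle_of_linear[OF assms] cocycle_of_inj[OF assms]
      cocycle_of_surj[OF assms])+
  note B = leibniz_algebra.BL2_submodule[OF R4_leibniz[OF assms]]
  have H: "vectorspace.fin_dim complex_field (HL2 (R4 n))"
    "vectorspace.dim complex_field (HL2 (R4 n)) = 1"
    "vectorspace.basis complex_field (HL2 (R4 n)) {HL2_class (R4 n) v}"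
    if "v \<in> carrier (ZL2 (R4 n))" "obstruction n v \<noteq> 0" for v
    unfolding HL2_def HL2_class_def
    by (rule quotient_space_basis_singleton[OF Z B, where \<kappa> = "obstruction n" and v = v];
        simp add: that BL2_iff_obstruction[OF assms] obstruction_linear[OF assms])+
  \<comment> \<open>The class of \<open>\<sigma>\<close> is nonzero for every
    \<open>n \<ge> 3\<close>, so it gives the dimension of \<open>HL2\<close> also for
    \<open>n = 3\<close>, where \<open>rho\<close> cannot.\<close>
  have "obstruction n (ideal_cocycle n) = 1"
    using assms by (simp add: obstruction_def ideal_cocycle_nth)
  then have H_dim: "vectorspace.fin_dim complex_field (HL2 (R4 n))"
    "vectorspace.dim complex_field (HL2 (R4 n)) = 1"
    using H(1,2)[OF ideal_cocycle_in_ZL2[OF assms]] by simp_all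
  have "vectorspace.basis complex_field (HL2 (R4 n)) {HL2_class (R4 n) (rho n)}" if "n \<ge> 4"
  proof (rule H(3))
    show "rho n \<in> carrier (ZL2 (R4 n))"
      using assms by (simp add: rho_eq_cocycle_of cocycle_of_in_ZL2)
    have "obstruction n (rho n) = of_nat n - 3"
      using assms by (simp add: rho_eq_cocycle_of obstruction_cocycle_of)
    also have "\<dots> = of_nat (n - 3)" using that by (simp add: of_nat_diff)
    finally show "obstruction n (rho n) \<noteq> 0" using that by (simp only: of_nat_eq_0_iff)
  qed
  then show ?thesis using Z_dim H_dim by blast
qed

end
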